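(* Let $G$ be an outer-planar graph of order $n$, and let $\mathcal{H}=K_1\nabla P_{n-1}$. Then $q(G)\leq q(\mathcal{H})$, with equality if and only if $G\cong \mathcal{H}$.
   Context: All graphs are finite, undirected and simple (no loops or multiple edges). For a graph $G$ with vertices $v_1,\dots,v_n$, the signless Laplacian matrix is $Q(G)=D(G)+A(G)$, where $D(G)=\mathrm{diag}(d(v_1),\dots,d(v_n))$ is the diagonal matrix of vertex degrees and $A(G)$ is the adjacency matrix; the $Q$-index $q(G)$ is the largest eigenvalue of $Q(G)$. A graph is outer-planar if it has a planar embedding in which all vertices lie on the boundary of the outer face. $K_1$ is the one-vertex graph and $P_{n-1}$ is the path on $n-1$ vertices (for $n=1$, $P_0$ is the graph with no vertices). The join $G\nabla H$ of disjoint graphs $G$ and $H$ is obtained from $G\cup H$ by joining each vertex of $G$ to each vertex of $H$. *)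

theory Defs
  imports "HOL-Analysis.Analysis" "Jordan_Normal_Form.Char_Poly"
begin

record 'a graph =
  verts :: "'a set"
  edges :: "'a set set"

definition simple_graph :: "'a graph \<Rightarrow> bool" where
  "simple_graph G \<longleftrightarrow> finite (verts G) \<and> (\<forall>e\<in>edges G. e \<subseteq> verts G \<and> card e = 2)"

definition graph_iso :: "'a graph \<Rightarrow> 'b graph \<Rightarrow> bool" (infix "\<cong>\<^sub>g" 50) where
  "G \<cong>\<^sub>g H \<longleftrightarrow> (\<exists>f. bij_betw f (verts G) (verts H) \<and>
     (\<forall>u\<in>verts G. \<forall>v\<in>verts G. {u, v} \<in> edges G \<longleftrightarrow> {f u, f v} \<in> edges H))"

definition K1 :: "unit graph" where
  "K1 = \<lparr>verts = {()}, edges = {}\<rparr>"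

definition path_graph :: "nat \<Rightarrow> nat graph" where
  "path_graph m = \<lparr>verts = {..<m}, edges = {{i, Suc i} | i. Suc i < m}\<rparr>"

(* The sum type makes the two vertex sets disjoint. *)
definition graph_join :: "'a graph \<Rightarrow> 'b graph \<Rightarrow> ('a + 'b) graph" (infixr "\<nabla>" 65) where
  "G \<nabla> H = \<lparr>verts = verts G <+> verts H,
     edges = image Inl ` edges G \<union> image Inr ` edges H \<union>
       {{Inl u, Inr v} | u v. u \<in> verts G \<and> v \<in> verts H}\<rparr>"

definition vertex_degree :: "'a graph \<Rightarrow> 'a \<Rightarrow> nat" where
  "vertex_degree G v = card {u \<in> verts G. {v, u} \<in> edges G}"

(* In the matrices below, the list vs enumerates the vertices v_1, ..., v_n. *)

definition adjacency_matrix :: "'a graph \<Rightarrow> 'a list \<Rightarrow> real mat" where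
  "adjacency_matrix G vs = Matrix.mat (length vs) (length vs)
     (\<lambda>(i, j). if {vs ! i, vs ! j} \<in> edges G then 1 else 0)"

definition degree_matrix :: "'a graph \<Rightarrow> 'a list \<Rightarrow> real mat" where
  "degree_matrix G vs = Matrix.mat (length vs) (length vs)
     (\<lambda>(i, j). if i = j then real (vertex_degree G (vs ! i)) else 0)"

definition signless_laplacian :: "'a graph \<Rightarrow> 'a list \<Rightarrow> real mat" where
  "signless_laplacian G vs = degree_matrix G vs + adjacency_matrix G vs"

(* The choice of enumeration is immaterial: another one conjugates the matrix by a
   permutation matrix. The matrix is real symmetric, so all its eigenvalues are real. *)
definition q_index :: "'a graph \<Rightarrow> real" where
  "q_index G =
     (let vs = (SOME vs. distinct vs \<and> set vs = verts G)
      in Max {k. eigenvalue (signless_laplacian G vs) k})"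

(* A drawing places vertex v at the point p v and represents edge e by the simple arc c e. *)
definition planar_embedding ::
    "'a graph \<Rightarrow> ('a \<Rightarrow> complex) \<Rightarrow> ('a set \<Rightarrow> real \<Rightarrow> complex) \<Rightarrow> bool" where
  "planar_embedding G p c \<longleftrightarrow>
     inj_on p (verts G) \<and>
     (\<forall>e\<in>edges G. arc (c e) \<and> {pathstart (c e), pathfinish (c e)} = p ` e \<and>
        path_image (c e) \<inter> p ` verts G = p ` e) \<and>
     (\<forall>e\<in>edges G. \<forall>e'\<in>edges G. e \<noteq> e' \<longrightarrow>
        path_image (c e) \<inter> path_image (c e') \<subseteq> p ` (e \<inter> e'))"

definition drawing :: "'a graph \<Rightarrow> ('a \<Rightarrow> complex) \<Rightarrow> ('a set \<Rightarrow> real \<Rightarrow> complex) \<Rightarrow> complex set" where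
  "drawing G p c = p ` verts G \<union> (\<Union>e\<in>edges G. path_image (c e))"

(* The drawing of a finite graph is compact, so outside (drawing G p c) is the unique
   unbounded component of its complement, i.e. the outer face. *)
definition outerplanar :: "'a graph \<Rightarrow> bool" where
  "outerplanar G \<longleftrightarrow> (\<exists>p c. planar_embedding G p c \<and>
     p ` verts G \<subseteq> frontier (outside (drawing G p c)))"

end

theory Submission
  imports Defs
begin

text \<open>Write \<open>n\<close> for the order of \<open>G\<close>, and call \<open>K\<^sub>1 \<nabla> P\<^sub>n\<^sub>-\<^sub>1\<close> the fan.

  Only two consequences of outerplanarity are used.  Two vertices have at most two common neighbours,
  because \<open>K\<^sub>2\<^sub>,\<^sub>3\<close> has no outer drawing; and the neighbours of a vertex can be listed so that every edge
  between them joins consecutive ones, because a wheel has no outer drawing either.  Both exclusions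
  come from theta curves: of three arcs with common ends that are otherwise disjoint, one runs inside
  the closed curve formed by the other two (\<open>theta_one_arc_inside\<close>), and in an outer drawing such an
  arc carries no vertex.  The locale \<open>sparse_neighbourhoods\<close> records the two consequences, and
  everything after it is combinatorial.

  On the spectral side, the Q-index is the maximum of the Rayleigh quotient of the quadratic form
  that sums \<open>(y u + y v)\<^sup>2\<close> over the edges \<open>uv\<close> (\<open>q_index_variational\<close>).  Test functions therefore bound
  it from below.  From above it is bounded by any \<open>k\<close> for which some positive weights \<open>y\<close> satisfy
  \<open>Q y \<le> k y\<close> (\<open>q_index_le_weights\<close>).

  If some vertex is adjacent to all others, the list of its neighbours exhibits \<open>G\<close> as a spanning
  subgraph of a fan.  Unless it is the whole fan, its Q-index is strictly smaller, as the dominating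
  vertex makes the nonnegative eigenfunction positive (\<open>dominated_iso_or_less\<close>).

  Otherwise all degrees are at most \<open>n - 2\<close>, and the Q-index lies strictly below that of the fan
  (\<open>undominated_less\<close>).  The latter is about \<open>n + 4/n\<close>.  Degrees as weights give the bound
  \<open>d + 1 + (2n - 4)/d\<close> for the row of a vertex of degree \<open>d\<close>; this suffices for degrees up to \<open>n - 3\<close>,
  but at \<open>n - 2\<close> it yields \<open>n + 1\<close>.  A vertex of that degree gets weights of its own
  (\<open>q_index_le_hub\<close>), and orders up to six are treated separately.\<close>

section \<open>Theta curves in the plane\<close>

lemma connected_inside_or_misses:
  fixes S T :: "complex set"
  assumes "closed S" "connected T" "T \<inter> S = {}"
  shows "T \<subseteq> inside S \<or> T \<inter> inside S = {}"
proof -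
  have "T \<subseteq> inside S \<union> outside S"
    using assms(3) by (auto simp: inside_Un_outside)
  moreover have "open (inside S)" "open (outside S)" "inside S \<inter> outside S = {}"
    using assms(1) by (auto simp: open_inside open_outside)
  ultimately show ?thesis
    using connectedD[OF assms(2), of "inside S" "outside S"] by blast
qed

lemma closed_curve_of_two_arcs:
  fixes c1 c2 :: "real \<Rightarrow> complex"
  assumes "arc c1" "pathstart c1 = a" "pathfinish c1 = b"
    and "arc c2" "pathstart c2 = a" "pathfinish c2 = b"
    and "path_image c1 \<inter> path_image c2 = {a, b}"
  defines "S \<equiv> path_image c1 \<union> path_image c2"
  shows "inside S \<noteq> {}" "connected (inside S)" "frontier (inside S) = S"
    "connected (outside S)" "closed S" "compact S"
proof -
  let ?l = "c1 +++ reversepath c2"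
  have sp: "simple_path ?l"
    by (rule simple_path_join_loop) (use assms in \<open>auto simp: arc_reversepath\<close>)
  have cl: "pathfinish ?l = pathstart ?l" and im: "path_image ?l = S"
    using assms by (auto simp: path_image_join)
  from Jordan_inside_outside[OF sp cl] 
  show "inside S \<noteq> {}" "connected (inside S)" "frontier (inside S) = S"
    "connected (outside S)" by (simp_all add: im)
  show "closed S" "compact S"
    using assms by (auto simp: S_def closed_arc_image compact_arc_image)
qed

text \<open>If the two insides met, each would be contained in the other.  Equal insides have equal boundaries,
  but the second and the third arc differ.\<close>

lemma theta_insides_disjoint:
  fixes c1 c2 c3 :: "real \<Rightarrow> complex"
  assumes c1: "arc c1" "pathstart c1 = a" "pathfinish c1 = b"
    and c2: "arc c2" "pathstart c2 = a" "pathfinish c2 = b"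
    and c3: "arc c3" "pathstart c3 = a" "pathfinish c3 = b"
    and i12: "path_image c1 \<inter> path_image c2 = {a, b}"
    and i13: "path_image c1 \<inter> path_image c3 = {a, b}"
    and i23: "path_image c2 \<inter> path_image c3 = {a, b}"
    and out3: "(path_image c3 - {a, b}) \<inter> inside (path_image c1 \<union> path_image c2) = {}"
    and out2: "(path_image c2 - {a, b}) \<inter> inside (path_image c1 \<union> path_image c3) = {}"
  shows "inside (path_image c1 \<union> path_image c2) \<inter> inside (path_image c1 \<union> path_image c3) = {}"
proof (rule ccontr)
  let ?S = "path_image c1 \<union> path_image c2" and ?T = "path_image c1 \<union> path_image c3"
  note S = closed_curve_of_two_arcs[OF c1 c2 i12] and T = closed_curve_of_two_arcs[OF c1 c3 i13]
  have ab: "a \<in> path_image c1" "b \<in> path_image c1" using i12 by auto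
  have noS: "inside ?S \<inter> ?S = {}" and noT: "inside ?T \<inter> ?T = {}" by simp_all
  assume meet: "inside ?S \<inter> inside ?T \<noteq> {}"
  have "inside ?S \<inter> ?T = {}" using out3 noS ab by blast
  then have "inside ?S \<subseteq> inside ?T"
    using connected_inside_or_misses[OF T(5) S(2)] meet by blast
  moreover have "inside ?T \<inter> ?S = {}" using out2 noT ab by blast
  then have "inside ?T \<subseteq> inside ?S"
    using connected_inside_or_misses[OF S(5) T(2)] meet by blast
  ultimately have "?S = ?T" using S(3) T(3) by (metis subset_antisym)
  moreover have "path_image c2 - {a, b} \<noteq> {}"
    using nonempty_simple_path_endless[OF arc_imp_simple_path[OF c2(1)]] c2 by simp
  ultimately show False using i12 i23 by blast
qed

text \<open>If no arc ran inside the other two, a point inside the first two arcs could be joined to infinity without meeting the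
  closed curve through the first and third arc, and also without meeting the one through the second
  and third.  These two curves share the third arc, which is connected, so Janiszewski's theorem
  gives a connection that avoids both of them, hence also the curve around the point.\<close>

lemma theta_one_arc_inside:
  fixes c1 c2 c3 :: "real \<Rightarrow> complex"
  assumes c1: "arc c1" "pathstart c1 = a" "pathfinish c1 = b"
    and c2: "arc c2" "pathstart c2 = a" "pathfinish c2 = b"
    and c3: "arc c3" "pathstart c3 = a" "pathfinish c3 = b"
    and i12: "path_image c1 \<inter> path_image c2 = {a, b}"
    and i13: "path_image c1 \<inter> path_image c3 = {a, b}"
    and i23: "path_image c2 \<inter> path_image c3 = {a, b}"
  shows "path_image c1 - {a, b} \<subseteq> inside (path_image c2 \<union> path_image c3) \<or>
         path_image c2 - {a, b} \<subseteq> inside (path_image c1 \<union> path_image c3) \<or>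
         path_image c3 - {a, b} \<subseteq> inside (path_image c1 \<union> path_image c2)"
proof (rule ccontr)
  let ?A = "path_image c1 \<union> path_image c2" and ?B = "path_image c1 \<union> path_image c3"
    and ?C = "path_image c2 \<union> path_image c3"
  assume neg: "\<not> ?thesis"
  note A = closed_curve_of_two_arcs[OF c1 c2 i12] and B = closed_curve_of_two_arcs[OF c1 c3 i13]
    and C = closed_curve_of_two_arcs[OF c2 c3 i23]
  have endless: "connected (path_image c1 - {a, b})" "connected (path_image c2 - {a, b})"
    "connected (path_image c3 - {a, b})"
    using connected_simple_path_endless[OF arc_imp_simple_path] c1 c2 c3 by metis+
  have o1: "(path_image c1 - {a, b}) \<inter> inside ?C = {}"
    using connected_inside_or_misses[OF C(5) endless(1)] neg i12 i13 by blast
  have o2: "(path_image c2 - {a, b}) \<inter> inside ?B = {}"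
    using connected_inside_or_misses[OF B(5) endless(2)] neg i12 i23 by blast
  have o3: "(path_image c3 - {a, b}) \<inter> inside ?A = {}"
    using connected_inside_or_misses[OF A(5) endless(3)] neg i13 i23 by blast
  have AB: "inside ?A \<inter> inside ?B = {}"
    by (rule theta_insides_disjoint[OF c1 c2 c3 i12 i13 i23 o3 o2])
  have AC: "inside ?A \<inter> inside ?C = {}"
    using theta_insides_disjoint[OF c2 c1 c3] i12 i13 i23 o3 o1
    by (simp add: Int_commute Un_commute)
  obtain x where x: "x \<in> inside ?A" using A(1) by blast
  have bd: "bounded (?B \<union> ?C)" using compact_imp_bounded[OF compact_Un[OF B(6) C(6)]] .
  obtain y where y: "y \<in> outside (?B \<union> ?C)" using outside_bounded_nonempty[OF bd] by blast
  have ab: "a \<in> path_image c2" "b \<in> path_image c2" using i12 by auto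
  have noA: "inside ?A \<inter> ?A = {}" by simp
  have nx: "x \<notin> ?B" "x \<notin> ?C" using x noA o3 ab by blast+
  have xB: "x \<in> outside ?B" and xC: "x \<in> outside ?C"
    using nx x AB AC inside_Un_outside by blast+
  have yB: "y \<in> outside ?B" and yC: "y \<in> outside ?C" and yA: "y \<in> outside ?A"
    using y outside_mono[of ?B "?B \<union> ?C"] outside_mono[of ?C "?B \<union> ?C"]
      outside_mono[of ?A "?B \<union> ?C"] by blast+
  have "connected_component (- (?B \<union> ?C)) x y"
  proof (rule Janiszewski)
    have "?B \<inter> ?C = path_image c3" using i12 i13 i23 by blast
    then show "connected (?B \<inter> ?C)" using connected_arc_image[OF c3(1)] by simp
    show "connected_component (- ?B) x y"
      unfolding connected_component_def using B(4) xB yB outside_no_overlap[of ?B] by blast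
    show "connected_component (- ?C) x y"
      unfolding connected_component_def using C(4) xC yC outside_no_overlap[of ?C] by blast
  qed (use B C in auto)
  then obtain T where T: "connected T" "T \<subseteq> - (?B \<union> ?C)" "x \<in> T" "y \<in> T"
    unfolding connected_component_def by blast
  then have "y \<in> inside ?A"
    using connected_inside_or_misses[OF A(5) T(1)] x by blast
  then show False using yA inside_Int_outside by blast
qed

section \<open>Paths and outer drawings\<close>

fun path_edges :: "'a list \<Rightarrow> 'a set set" where
  "path_edges (u # v # vs) = insert {u, v} (path_edges (v # vs))"
| "path_edges _ = {}"

lemma path_edges_subset: "e \<in> path_edges vs \<Longrightarrow> e \<subseteq> set vs"
  by (induction vs rule: path_edges.induct) auto

lemma path_edges_cover: "length vs \<ge> 2 \<Longrightarrow> \<Union>(path_edges vs) = set vs"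
proof (induction vs rule: path_edges.induct)
  case (1 u v vs)
  then show ?case by (cases vs) auto
qed auto

lemma endpoints_not_adjacent_on_path:
  assumes "distinct vs" "length vs \<ge> 3"
  shows "{hd vs, last vs} \<notin> path_edges vs"
proof -
  obtain u v w ws where vs: "vs = u # v # w # ws"
    using assms(2) by (cases vs rule: remdups_adj.cases; cases "tl (tl vs)") auto
  then have "last vs \<noteq> v" "u \<notin> set (v # w # ws)" using assms(1) by auto
  then show ?thesis using path_edges_subset[of _ "v # w # ws"] 
    unfolding vs by (auto simp: doubleton_eq_iff)
qed

lemma finite_path_edges: "finite (path_edges vs)"
  by (induction vs rule: path_edges.induct) auto

lemma path_edges_append:
  "path_edges (us @ v # vs) = path_edges (us @ [v]) \<union> path_edges (v # vs)"
  by (induction us rule: path_edges.induct) auto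

lemma path_edges_rev: "path_edges (rev vs) = path_edges vs"
proof (induction vs rule: path_edges.induct)
  case (1 u v vs)
  have "path_edges (rev (u # v # vs)) = path_edges (rev vs @ [v]) \<union> path_edges [v, u]"
    using path_edges_append[of "rev vs" v "[u]"] by simp
  then show ?case using 1 by (auto simp: insert_commute)
qed auto

locale outer_drawing =
  fixes G :: "'a graph" and p :: "'a \<Rightarrow> complex" and c :: "'a set \<Rightarrow> real \<Rightarrow> complex"
  assumes simple: "simple_graph G"
    and embedding: "planar_embedding G p c"
    and outer: "p ` verts G \<subseteq> frontier (outside (drawing G p c))"
begin

definition drawn :: "'a set set \<Rightarrow> complex set" where
  "drawn E = (\<Union>e\<in>E. path_image (c e))"

text \<open>An open inside of \<open>S\<close> that contains an outer vertex also contains points of the outer face, but the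
  outer face lies outside the smaller set \<open>S\<close>.\<close>

lemma vertex_not_inside:
  assumes "v \<in> verts G" "closed S" "S \<subseteq> drawing G p c"
  shows "p v \<notin> inside S"
proof
  assume "p v \<in> inside S"
  moreover have "p v \<in> closure (outside (drawing G p c))"
    using outer assms(1) by (auto simp: frontier_def)
  ultimately have "inside S \<inter> outside (drawing G p c) \<noteq> {}"
    using open_inside[OF assms(2)] closure_iff_nhds_not_empty by blast
  then show False
    using outside_mono[OF assms(3)] inside_Int_outside[of S] by blast
qed

lemma drawn_insert: "drawn (insert e E) = path_image (c e) \<union> drawn E"
  by (auto simp: drawn_def)

lemma drawn_subset: "E \<subseteq> edges G \<Longrightarrow> drawn E \<subseteq> drawing G p c"
  by (auto simp: drawn_def drawing_def)

lemma drawn_vertex: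
  assumes "E \<subseteq> edges G" "v \<in> verts G" "p v \<in> drawn E"
  shows "\<exists>e\<in>E. v \<in> e"
proof -
  obtain e where e: "e \<in> E" "p v \<in> path_image (c e)" using assms(3) by (auto simp: drawn_def)
  then have "p v \<in> path_image (c e) \<inter> p ` verts G" "e \<in> edges G" using assms by auto
  then have "p v \<in> p ` e" using embedding unfolding planar_embedding_def by metis
  moreover have "e \<subseteq> verts G" using simple e assms(1) by (auto simp: simple_graph_def)
  moreover have "inj_on p (verts G)" using embedding by (simp add: planar_embedding_def)
  ultimately show ?thesis using e(1) assms(2) by (meson inj_on_image_mem_iff)
qed

lemma vertex_drawn:
  assumes "E \<subseteq> edges G" "e \<in> E" "v \<in> e"
  shows "p v \<in> drawn E"
  using assms embedding by (fastforce simp: planar_embedding_def drawn_def)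

lemma drawn_Int:
  assumes "E \<subseteq> edges G" "F \<subseteq> edges G" "E \<inter> F = {}"
  shows "drawn E \<inter> drawn F \<subseteq> p ` (\<Union>E \<inter> \<Union>F)"
proof
  fix x assume "x \<in> drawn E \<inter> drawn F"
  then obtain e f where ef: "e \<in> E" "f \<in> F" "x \<in> path_image (c e) \<inter> path_image (c f)"
    by (auto simp: drawn_def)
  then have "e \<in> edges G" "f \<in> edges G" "e \<noteq> f" using assms by auto
  then have "x \<in> p ` (e \<inter> f)" using embedding ef(3) unfolding planar_embedding_def by blast
  then show "x \<in> p ` (\<Union>E \<inter> \<Union>F)" using ef by blast
qed

lemma edge_arc:
  assumes "{u, v} \<in> edges G"
  shows "\<exists>g. arc g \<and> pathstart g = p u \<and> pathfinish g = p v \<and> path_image g = path_image (c {u, v})"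
proof -
  have a: "arc (c {u, v})" and s: "{pathstart (c {u, v}), pathfinish (c {u, v})} = {p u, p v}"
    using embedding assms unfolding planar_embedding_def by (metis image_empty image_insert)+
  from s consider "pathstart (c {u, v}) = p u" "pathfinish (c {u, v}) = p v"
    | "pathstart (c {u, v}) = p v" "pathfinish (c {u, v}) = p u"
    by (auto simp: doubleton_eq_iff)
  then show ?thesis
  proof cases
    case 1 then show ?thesis using a by blast
  next
    case 2 then show ?thesis
      using a by (intro exI[of _ "reversepath (c {u, v})"]) (simp add: arc_reversepath)
  qed
qed

lemma path_arc:
  assumes "distinct vs" "path_edges vs \<subseteq> edges G" "length vs \<ge> 2"
  shows "\<exists>g. arc g \<and> pathstart g = p (hd vs) \<and> pathfinish g = p (last vs) \<and>
    path_image g = drawn (path_edges vs)"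
  using assms
proof (induction vs rule: path_edges.induct)
  case (1 u v vs)
  have uv: "{u, v} \<in> edges G" using 1 by simp
  obtain g1 where g1: "arc g1" "pathstart g1 = p u" "pathfinish g1 = p v"
    "path_image g1 = drawn {{u, v}}"
    using edge_arc[OF uv] by (auto simp: drawn_def)
  show ?case
  proof (cases "vs = []")
    case True
    then show ?thesis using g1 by auto
  next
    case False
    then have "length (v # vs) \<ge> 2" by (cases vs) auto
    then obtain g2 where g2: "arc g2" "pathstart g2 = p v" "pathfinish g2 = p (last (v # vs))"
      "path_image g2 = drawn (path_edges (v # vs))"
      using 1 by auto
    have "\<Union>{{u, v}} \<inter> \<Union>(path_edges (v # vs)) \<subseteq> {v}"
      and "{{u, v}} \<inter> path_edges (v # vs) = {}"
      using path_edges_subset[of _ "v # vs"] 1(2) by auto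
    moreover have "drawn {{u, v}} \<inter> drawn (path_edges (v # vs)) \<subseteq>
        p ` (\<Union>{{u, v}} \<inter> \<Union>(path_edges (v # vs)))"
      using calculation(2) 1(3) by (intro drawn_Int) auto
    moreover have "p ` (\<Union>{{u, v}} \<inter> \<Union>(path_edges (v # vs))) \<subseteq> p ` {v}"
      using calculation(1) by (rule image_mono)
    ultimately have "path_image g1 \<inter> path_image g2 \<subseteq> {p v}"
      unfolding g1(4) g2(4) by auto
    then have "arc (g1 +++ g2)" using g1 g2 by (intro arc_join) auto
    moreover have "path_image (g1 +++ g2) = drawn (path_edges (u # v # vs))"
      using g1 g2 by (subst path_image_join) (auto simp: drawn_def)
    ultimately show ?thesis using g1 g2 False by (intro exI[of _ "g1 +++ g2"]) auto
  qed
qed auto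

definition path_between :: "'a \<Rightarrow> 'a \<Rightarrow> 'a list \<Rightarrow> bool" where
  "path_between a b vs \<longleftrightarrow> distinct vs \<and> path_edges vs \<subseteq> edges G \<and> length vs \<ge> 2 \<and>
     hd vs = a \<and> last vs = b"

lemma path_between_verts: "path_between a b vs \<Longrightarrow> set vs \<subseteq> verts G"
  using path_edges_cover[of vs] simple unfolding path_between_def simple_graph_def by blast

lemma drawn_paths_Int:
  assumes P: "path_between a b vs" "path_between a b ws"
    and "set vs \<inter> set ws = {a, b}" "path_edges vs \<inter> path_edges ws = {}"
  shows "drawn (path_edges vs) \<inter> drawn (path_edges ws) = {p a, p b}"
proof
  have cov: "\<Union>(path_edges vs) = set vs" "\<Union>(path_edges ws) = set ws"
    using P path_edges_cover unfolding path_between_def by blast+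
  show "drawn (path_edges vs) \<inter> drawn (path_edges ws) \<subseteq> {p a, p b}"
    using drawn_Int[of "path_edges vs" "path_edges ws"] P assms(3,4)
    by (auto simp: path_between_def cov)
  have "p x \<in> drawn (path_edges us)" if "path_between a b us" "x \<in> set us" for x us
  proof -
    have "x \<in> \<Union>(path_edges us)" using that path_edges_cover unfolding path_between_def by blast
    then show ?thesis using that vertex_drawn unfolding path_between_def by blast
  qed
  moreover have "{a, b} \<subseteq> set vs" "{a, b} \<subseteq> set ws" using assms(3) by auto
  ultimately show "{p a, p b} \<subseteq> drawn (path_edges vs) \<inter> drawn (path_edges ws)"
    using P by auto
qed

lemma path_edges_disjoint:
  assumes P: "path_between a b vs" "path_between a b ws" and l: "length vs \<ge> 3"
    and I: "set vs \<inter> set ws = {a, b}"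
  shows "path_edges vs \<inter> path_edges ws = {}"
proof (rule ccontr)
  assume "path_edges vs \<inter> path_edges ws \<noteq> {}"
  then obtain e where e: "e \<in> path_edges vs" "e \<in> path_edges ws" by blast
  then have "e \<subseteq> {a, b}" using path_edges_subset I by blast
  moreover have "card e = 2" using e P simple by (auto simp: path_between_def simple_graph_def)
  ultimately have "e = {a, b}" by (intro card_seteq) (auto intro: card_insert_le_m1)
  then show False
    using e(1) endpoints_not_adjacent_on_path[of vs] P l by (auto simp: path_between_def)
qed

text \<open>Such a path has an inner vertex, and no vertex lies inside a union of drawn edges.\<close>

lemma long_path_not_inside:
  assumes P: "path_between a b vs" and l: "length vs \<ge> 3"
    and E: "E \<subseteq> edges G" "finite E"
  shows "\<not> drawn (path_edges vs) - {p a, p b} \<subseteq> inside (drawn E)"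
proof
  assume inside: "drawn (path_edges vs) - {p a, p b} \<subseteq> inside (drawn E)"
  obtain u v w ws where vs: "vs = u # v # w # ws"
    using l by (cases vs rule: remdups_adj.cases; cases "tl (tl vs)") auto
  have v: "v \<in> verts G" "a \<in> verts G" "b \<in> verts G"
    using path_between_verts[OF P] P last_in_set[of vs] by (auto simp: vs path_between_def)
  have "b \<in> set (w # ws)" using P last_in_set[of "w # ws"] by (simp add: vs path_between_def del: set_simps)
  then have "v \<noteq> a" "v \<noteq> b" using P by (auto simp: vs path_between_def)
  then have "p v \<noteq> p a" "p v \<noteq> p b"
    using embedding v by (auto simp: planar_embedding_def dest: inj_onD)
  moreover have "p v \<in> drawn (path_edges vs)"
    using vertex_drawn[of "path_edges vs" "{u, v}"] P by (auto simp: vs path_between_def)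
  ultimately have "p v \<in> inside (drawn E)" using inside by blast
  moreover have "closed (drawn E)"
    unfolding drawn_def using E embedding
    by (intro closed_UN) (auto simp: planar_embedding_def intro: closed_arc_image)
  ultimately show False using vertex_not_inside v(1) drawn_subset[OF E(1)] by blast
qed

text \<open>In an outer drawing the only arc of a theta curve that can lie inside the other two is a
  single edge, because any other arc carries a vertex in its interior.\<close>

lemma theta_short_arc_inside:
  assumes P: "path_between a b us" "path_between a b vs" "path_between a b ws"
    and l: "length vs \<ge> 3" "length ws \<ge> 3"
    and I: "set us \<inter> set vs = {a, b}" "set us \<inter> set ws = {a, b}" "set vs \<inter> set ws = {a, b}"
  shows "drawn (path_edges us) - {p a, p b} \<subseteq> inside (drawn (path_edges vs) \<union> drawn (path_edges ws))"
proof -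
  have J: "path_edges us \<inter> path_edges vs = {}" "path_edges us \<inter> path_edges ws = {}"
    "path_edges vs \<inter> path_edges ws = {}"
    using path_edges_disjoint[OF P(2) P(1) l(1)] path_edges_disjoint[OF P(3) P(1) l(2)]
      path_edges_disjoint[OF P(2) P(3) l(1)] I by blast+
  have E: "path_edges us \<subseteq> edges G" "path_edges vs \<subseteq> edges G" "path_edges ws \<subseteq> edges G"
    using P by (auto simp: path_between_def)
  obtain g1 g2 g3 where g: "arc g1" "pathstart g1 = p a" "pathfinish g1 = p b"
      "arc g2" "pathstart g2 = p a" "pathfinish g2 = p b"
      "arc g3" "pathstart g3 = p a" "pathfinish g3 = p b"
    and im: "path_image g1 = drawn (path_edges us)" "path_image g2 = drawn (path_edges vs)"
      "path_image g3 = drawn (path_edges ws)"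
    using path_arc P unfolding path_between_def by metis
  have Un: "drawn A \<union> drawn B = drawn (A \<union> B)" for A B by (auto simp: drawn_def)
  have "\<not> drawn (path_edges vs) - {p a, p b} \<subseteq> inside (drawn (path_edges us) \<union> drawn (path_edges ws))"
    unfolding Un by (rule long_path_not_inside[OF P(2) l(1)]) (use E finite_path_edges in auto)
  moreover have "\<not> drawn (path_edges ws) - {p a, p b} \<subseteq> inside (drawn (path_edges us) \<union> drawn (path_edges vs))"
    unfolding Un by (rule long_path_not_inside[OF P(3) l(2)]) (use E finite_path_edges in auto)
  ultimately show ?thesis
    using theta_one_arc_inside[OF g] drawn_paths_Int[OF P(1,2) I(1) J(1)]
      drawn_paths_Int[OF P(1,3) I(2) J(2)] drawn_paths_Int[OF P(2,3) I(3) J(3)]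
    unfolding im by blast
qed

text \<open>This is the source of all forbidden subgraphs except the complete graph on four vertices.\<close>

lemma no_theta:
  assumes P: "path_between a b us" "path_between a b vs" "path_between a b ws"
    and l: "length us \<ge> 3" "length vs \<ge> 3" "length ws \<ge> 3"
    and I: "set us \<inter> set vs = {a, b}" "set us \<inter> set ws = {a, b}" "set vs \<inter> set ws = {a, b}"
  shows False
proof -
  have "drawn (path_edges us) - {p a, p b} \<subseteq> inside (drawn (path_edges vs \<union> path_edges ws))"
    using theta_short_arc_inside[OF P l(2,3) I] by (auto simp: drawn_def)
  then show False
    using long_path_not_inside[OF P(1) l(1), of "path_edges vs \<union> path_edges ws"] P finite_path_edges
    by (auto simp: path_between_def)
qed

lemma no_K23:
  assumes "distinct [a, b, x, y, z]"
    and "{a, x} \<in> edges G" "{a, y} \<in> edges G" "{a, z} \<in> edges G"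
    and "{b, x} \<in> edges G" "{b, y} \<in> edges G" "{b, z} \<in> edges G"
  shows False
proof -
  have "{x, b} \<in> edges G" "{y, b} \<in> edges G" "{z, b} \<in> edges G"
    using assms(5-7) by (simp_all only: insert_commute)
  then show False
    using no_theta[of a b "[a, x, b]" "[a, y, b]" "[a, z, b]"] assms by (auto simp: path_between_def)
qed

text \<open>The disjoint edges \<open>xy\<close> and \<open>zw\<close> both run inside the 4-cycle formed by the other four edges.  The
  edge \<open>xy\<close> cuts that inside into two parts, neither of which has both \<open>z\<close> and \<open>w\<close> on its boundary, so
  \<open>zw\<close> would have to cross \<open>xy\<close>.\<close>

lemma no_K4:
  assumes d: "distinct [x, y, z, w]"
    and e: "{x, y} \<in> edges G" "{x, z} \<in> edges G" "{x, w} \<in> edges G"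
      "{y, z} \<in> edges G" "{y, w} \<in> edges G" "{z, w} \<in> edges G"
  shows False
proof -
  let ?xy = "drawn (path_edges [x, y])" and ?xzy = "drawn (path_edges [x, z, y])"
    and ?xwy = "drawn (path_edges [x, w, y])" and ?zw = "drawn (path_edges [z, w])"
  have e': "{z, x} \<in> edges G" "{w, y} \<in> edges G" "{z, y} \<in> edges G"
    using e by (simp_all only: insert_commute)
  have P: "path_between x y [x, y]" "path_between x y [x, z, y]" "path_between x y [x, w, y]"
    "path_between z w [z, w]" "path_between z w [z, x, w]" "path_between z w [z, y, w]"
    using d e e' by (auto simp: path_between_def)
  have xy_in: "?xy - {p x, p y} \<subseteq> inside (?xzy \<union> ?xwy)"
    by (rule theta_short_arc_inside[OF P(1-3)]) (use d in auto)
  have "?zw - {p z, p w} \<subseteq> inside (drawn (path_edges [z, x, w]) \<union> drawn (path_edges [z, y, w]))"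
    by (rule theta_short_arc_inside[OF P(4-6)]) (use d in auto)
  also have "drawn (path_edges [z, x, w]) \<union> drawn (path_edges [z, y, w]) = ?xzy \<union> ?xwy"
    by (simp add: drawn_insert insert_commute[of x z] insert_commute[of w y] insert_commute[of y z]) blast
  finally have zw_in: "?zw - {p z, p w} \<subseteq> inside (?xzy \<union> ?xwy)" .
  obtain g1 where g1: "arc g1" "pathstart g1 = p x" "pathfinish g1 = p y" "path_image g1 = ?xzy"
    using path_arc[of "[x, z, y]"] P(2) by (auto simp: path_between_def)
  obtain g2 where g2: "arc g2" "pathstart g2 = p x" "pathfinish g2 = p y" "path_image g2 = ?xwy"
    using path_arc[of "[x, w, y]"] P(3) by (auto simp: path_between_def)
  obtain g where g: "arc g" "pathstart g = p x" "pathfinish g = p y" "path_image g = ?xy"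
    using path_arc[of "[x, y]"] P(1) by (auto simp: path_between_def)
  obtain h where h: "arc h" "pathstart h = p z" "pathfinish h = p w" "path_image h = ?zw"
    using path_arc[of "[z, w]"] P(4) by (auto simp: path_between_def)
  have vx: "x \<in> verts G" "y \<in> verts G" "z \<in> verts G" "w \<in> verts G"
    using path_between_verts P by fastforce+
  have "p x \<noteq> p y" using embedding d vx by (auto simp: planar_embedding_def dest: inj_onD)
  moreover have "path_image g1 \<inter> path_image g2 = {p x, p y}"
    unfolding g1 g2 by (rule drawn_paths_Int[OF P(2,3)]) (use d in \<open>auto simp: doubleton_eq_iff\<close>)
  moreover have "path_image g1 \<inter> path_image g = {p x, p y}"
    unfolding g1 g by (rule drawn_paths_Int[OF P(2,1)]) (use d in \<open>auto simp: doubleton_eq_iff\<close>)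
  moreover have "path_image g2 \<inter> path_image g = {p x, p y}"
    unfolding g2 g by (rule drawn_paths_Int[OF P(3,1)]) (use d in \<open>auto simp: doubleton_eq_iff\<close>)
  moreover have "path_image g \<inter> inside (path_image g1 \<union> path_image g2) \<noteq> {}"
    using nonempty_simple_path_endless[OF arc_imp_simple_path[OF g(1)]] xy_in
    unfolding g1 g2 g by blast
  ultimately have split: "inside (?xzy \<union> ?xy) \<union> inside (?xwy \<union> ?xy) \<union> (?xy - {p x, p y})
      = inside (?xzy \<union> ?xwy)"
    using split_inside_simple_closed_curve[of g1 "p x" "p y" g2 g] arc_imp_simple_path g1 g2 g
    by metis
  let ?T = "?zw - {p z, p w}"
  have conn: "connected ?T"
    using connected_simple_path_endless[OF arc_imp_simple_path[OF h(1)]] h by simp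
  have Un: "drawn A \<union> drawn B = drawn (A \<union> B)" for A B by (auto simp: drawn_def)
  have "?zw \<inter> ?xy \<subseteq> p ` (\<Union>(path_edges [z, w]) \<inter> \<Union>(path_edges [x, y]))"
    by (rule drawn_Int) (use d e in \<open>auto simp: doubleton_eq_iff\<close>)
  then have Txy: "?T \<inter> ?xy = {}" using d by auto
  have clos: "p z \<in> closure ?T" "p w \<in> closure ?T"
  proof -
    have "continuous_on (closure {0<..<1}) h" using h(1) by (simp add: arc_def path_def)
    then have "h ` closure {0<..<1} \<subseteq> closure (h ` {0<..<1})"
      by (rule image_closure_subset) (auto intro: closure_subset[THEN subsetD])
    moreover have "h ` {0<..<1} = ?T"
      using simple_path_endless[OF arc_imp_simple_path[OF h(1)]] h by simp
    ultimately show "p z \<in> closure ?T" "p w \<in> closure ?T"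
      using h(2,3) image_eqI[of "p z" h 0 "{0..1}"] image_eqI[of "p w" h 1 "{0..1}"]
      by (auto simp: pathstart_def pathfinish_def)
  qed
  \<comment> \<open>The arc comes arbitrarily close to its ends, but an outer vertex off a curve is neither inside it nor
    on the boundary of its inside.\<close>
  have no_limit: "\<not> ?T \<subseteq> inside (drawn E)"
    if "E \<subseteq> edges G" "finite E" "v \<in> {z, w}" "v \<notin> \<Union>E" for E v
  proof
    assume T: "?T \<subseteq> inside (drawn E)"
    have cl: "closed (drawn E)"
      unfolding drawn_def using that embedding
      by (intro closed_UN) (auto simp: planar_embedding_def intro: closed_arc_image)
    have "p v \<in> closure (inside (drawn E))" using clos closure_mono[OF T] that(3) by blast
    then have "p v \<in> inside (drawn E) \<union> drawn E"
      using frontier_inside_subset[OF cl] closure_Un_frontier[of "inside (drawn E)"] by blast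
    moreover have "p v \<notin> drawn E" using drawn_vertex[OF that(1)] that vx by blast
    moreover have "p v \<notin> inside (drawn E)"
      using vertex_not_inside cl drawn_subset[OF that(1)] that(3) vx by blast
    ultimately show False by blast
  qed
  have 1: "\<not> ?T \<subseteq> inside (?xzy \<union> ?xy)"
    unfolding Un by (rule no_limit[of _ w]) (use P d finite_path_edges in \<open>auto simp: path_between_def\<close>)
  have 2: "\<not> ?T \<subseteq> inside (?xwy \<union> ?xy)"
    unfolding Un by (rule no_limit[of _ z]) (use P d finite_path_edges in \<open>auto simp: path_between_def\<close>)
  have cl: "closed (?xzy \<union> ?xy)" 
    using closed_arc_image[OF g1(1)] closed_arc_image[OF g(1)] unfolding g1 g by blast
  have "?T \<inter> ?xzy = {}"
    using drawn_Int[of "path_edges [z, w]" "path_edges [x, z, y]"] e e' d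
    by (auto simp: doubleton_eq_iff)
  then have "?T \<inter> (?xzy \<union> ?xy) = {}" using Txy by blast
  then have "?T \<inter> inside (?xzy \<union> ?xy) = {}"
    using connected_inside_or_misses[OF cl conn] 1 by blast
  then have "?T \<subseteq> inside (?xwy \<union> ?xy)" using zw_in split Txy by blast
  with 2 show False by blast
qed

text \<open>A rim of three vertices gives a complete graph on four.  In a longer rim, two vertices at distance
  two are joined both ways along the rim and through the hub, which is a theta.\<close>

lemma no_wheel:
  assumes d: "distinct (h # rs)" and l: "length rs \<ge> 3"
    and rim: "path_edges rs \<subseteq> edges G" "{last rs, hd rs} \<in> edges G"
    and spokes: "\<And>r. r \<in> set rs \<Longrightarrow> {h, r} \<in> edges G"
  shows False
proof -
  obtain a x b ts where rs: "rs = a # x # b # ts"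
    using l by (cases rs rule: remdups_adj.cases; cases "tl (tl rs)") auto
  show False
  proof (cases "ts = []")
    case True
    then show ?thesis
      using no_K4[of h a x b] d rim spokes by (auto simp: rs insert_commute)
  next
    case False
    let ?long = "a # rev (b # ts)"
    have "path_edges ?long = insert {a, last rs} (path_edges (b # ts))"
    proof -
      obtain t us where t: "rev ts = t # us" using False by (cases "rev ts") auto
      then have "last rs = t" using False hd_rev[of ts] by (simp add: rs)
      then show ?thesis using t path_edges_rev[of "b # ts"] by simp
    qed
    then have "path_between a b ?long"
      using d rim False by (auto simp: path_between_def rs insert_commute)
    moreover have "path_between a b [a, x, b]" "path_between a b [a, h, b]"
      using d rim spokes by (auto simp: path_between_def rs insert_commute)
    moreover have "length ?long \<ge> 3" using False by (cases ts) auto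
    ultimately show ?thesis
      using no_theta[of a b "[a, x, b]" "[a, h, b]" ?long] d by (auto simp: rs)
  qed
qed

end

section \<open>The quadratic form of the signless Laplacian\<close>

definition nbrs :: "'a graph \<Rightarrow> 'a \<Rightarrow> 'a set" where
  "nbrs G v = {u \<in> verts G. {v, u} \<in> edges G}"

text \<open>The row at \<open>v\<close> of the signless Laplacian applied to \<open>y\<close>.  Summing over the edges at \<open>v\<close> instead of the
  matrix entries makes the symmetry of the form a plain exchange of sums.\<close>

definition laplace :: "'a graph \<Rightarrow> ('a \<Rightarrow> real) \<Rightarrow> 'a \<Rightarrow> real" where
  "laplace G y v = (\<Sum>e | e \<in> edges G \<and> v \<in> e. sum y e)"

text \<open>The quadratic form of the signless Laplacian; that it grows with the edge set is evident from
  this form.\<close>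

definition energy :: "'a graph \<Rightarrow> ('a \<Rightarrow> real) \<Rightarrow> real" where
  "energy G y = (\<Sum>e\<in>edges G. (sum y e)\<^sup>2)"

lemma simple_graph_finite:
  assumes "simple_graph G"
  shows "finite (verts G)" "finite (edges G)" "finite (nbrs G v)"
proof -
  show "finite (verts G)" using assms by (simp add: simple_graph_def)
  moreover have "edges G \<subseteq> Pow (verts G)" using assms by (auto simp: simple_graph_def)
  ultimately show "finite (edges G)" "finite (nbrs G v)"
    by (auto simp: nbrs_def intro: finite_subset)
qed

lemma edge_cases:
  assumes "simple_graph G" "e \<in> edges G"
  obtains u v where "u \<noteq> v" "e = {u, v}" "u \<in> verts G" "v \<in> verts G"
proof -
  have "card e = 2" "e \<subseteq> verts G" using assms by (auto simp: simple_graph_def)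
  then show thesis using that by (auto simp: card_2_iff)
qed

lemma edgeD:
  assumes "simple_graph G" "{u, v} \<in> edges G"
  shows "u \<noteq> v" "u \<in> verts G" "v \<in> verts G"
  using assms by (auto simp: simple_graph_def dest!: bspec[of "edges G" _ "{u, v}"])

lemma nbrs_irrefl: "simple_graph G \<Longrightarrow> v \<notin> nbrs G v"
  using edgeD(1)[of G v v] by (auto simp: nbrs_def)

lemma nbrs_sym: "simple_graph G \<Longrightarrow> u \<in> nbrs G v \<Longrightarrow> v \<in> nbrs G u"
  using edgeD[of G v u] by (auto simp: nbrs_def insert_commute)

lemma nbrs_iff: "simple_graph G \<Longrightarrow> u \<in> nbrs G v \<longleftrightarrow> {v, u} \<in> edges G"
  using edgeD(3)[of G v u] by (auto simp: nbrs_def)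

lemma vertex_degree_nbrs: "vertex_degree G v = card (nbrs G v)"
  by (simp add: vertex_degree_def nbrs_def)

lemma laplace_nbrs:
  assumes "simple_graph G"
  shows "laplace G y v = real (card (nbrs G v)) * y v + (\<Sum>u\<in>nbrs G v. y u)"
proof -
  have "bij_betw (\<lambda>u. {v, u}) (nbrs G v) {e \<in> edges G. v \<in> e}"
    unfolding bij_betw_def
  proof
    show "inj_on (\<lambda>u. {v, u}) (nbrs G v)" by (auto simp: inj_on_def doubleton_eq_iff)
    show "(\<lambda>u. {v, u}) ` nbrs G v = {e \<in> edges G. v \<in> e}"
    proof
      show "{e \<in> edges G. v \<in> e} \<subseteq> (\<lambda>u. {v, u}) ` nbrs G v"
      proof
        fix e assume e: "e \<in> {e \<in> edges G. v \<in> e}"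
        then obtain a b where "e = {a, b}" "a \<in> verts G" "b \<in> verts G"
          using edge_cases[OF assms, of e] by blast
        then show "e \<in> (\<lambda>u. {v, u}) ` nbrs G v" using e by (auto simp: nbrs_def insert_commute)
      qed
    qed (auto simp: nbrs_def)
  qed
  then have "laplace G y v = (\<Sum>u\<in>nbrs G v. sum y {v, u})"
    unfolding laplace_def by (rule sum.reindex_bij_betw[symmetric])
  also have "\<dots> = (\<Sum>u\<in>nbrs G v. y v + y u)"
  proof (intro sum.cong refl)
    fix u assume "u \<in> nbrs G v"
    then have "v \<noteq> u" using nbrs_irrefl[OF assms] by blast
    then show "sum y {v, u} = y v + y u" by simp
  qed
  finally show ?thesis by (simp add: sum.distrib)
qed

lemma laplace_bilinear:
  assumes "simple_graph G"
  shows "(\<Sum>v\<in>verts G. z v * laplace G y v) = (\<Sum>e\<in>edges G. sum z e * sum y e)"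
proof -
  note fin = simple_graph_finite[OF assms]
  have "(\<Sum>v\<in>verts G. z v * laplace G y v) =
      (\<Sum>v\<in>verts G. \<Sum>e | e \<in> edges G \<and> v \<in> e. z v * sum y e)"
    by (simp add: laplace_def sum_distrib_left)
  also have "\<dots> = (\<Sum>e\<in>edges G. \<Sum>v | v \<in> verts G \<and> v \<in> e. z v * sum y e)"
    by (rule sum.swap_restrict[OF fin(1,2)])
  also have "\<dots> = (\<Sum>e\<in>edges G. \<Sum>v\<in>e. z v * sum y e)"
    using assms by (intro sum.cong refl) (auto simp: simple_graph_def)
  finally show ?thesis by (simp add: sum_distrib_right)
qed

lemma energy_laplace:
  "simple_graph G \<Longrightarrow> energy G y = (\<Sum>v\<in>verts G. y v * laplace G y v)"
  by (simp add: laplace_bilinear energy_def power2_eq_square)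

lemma energy_cong:
  assumes "simple_graph G" "\<And>v. v \<in> verts G \<Longrightarrow> y v = z v"
  shows "energy G y = energy G z"
proof -
  have "sum y e = sum z e" if "e \<in> edges G" for e
    using that assms by (intro sum.cong) (auto simp: simple_graph_def)
  then show ?thesis by (simp add: energy_def)
qed

lemma energy_scale: "energy G (\<lambda>v. k * y v) = k\<^sup>2 * energy G y"
  by (simp add: energy_def sum_distrib_left[symmetric] power_mult_distrib)

text \<open>A nonnegative maximiser of the energy on the unit sphere exists by compactness; absolute values
  may be taken because they do not decrease the square of any edge sum.\<close>

lemma energy_maximiser:
  assumes "simple_graph G" "verts G \<noteq> {}"
  obtains x where "\<And>v. 0 \<le> x v" "(\<Sum>v\<in>verts G. (x v)\<^sup>2) = 1"
    "\<And>y. energy G y \<le> energy G x * (\<Sum>v\<in>verts G. (y v)\<^sup>2)"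
proof -
  let ?V = "verts G"
  note fin = simple_graph_finite[OF assms(1)]
  define S where "S = {y :: 'a \<Rightarrow> real. (\<forall>v. v \<notin> ?V \<longrightarrow> y v = 0) \<and> (\<Sum>v\<in>?V. (y v)\<^sup>2) = 1}"
  let ?B = "\<lambda>v. if v \<in> ?V then {-1..1 :: real} else {0}"
  have coord: "continuous_on UNIV (\<lambda>y :: 'a \<Rightarrow> real. y v)" for v
    by simp
  have "compactin (product_topology (\<lambda>i::'a. euclidean) UNIV) (PiE UNIV ?B)"
    unfolding compactin_PiE by (auto simp: compactin_euclidean_iff)
  then have cB: "compact (PiE UNIV ?B)"
    by (simp add: euclidean_product_topology compactin_euclidean_iff)
  have "S = (\<Inter>v\<in>-?V. {y. y v = 0}) \<inter> {y. (\<Sum>v\<in>?V. (y v)\<^sup>2) = 1}"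
    by (auto simp: S_def)
  moreover have "closed {y :: 'a \<Rightarrow> real. y v = 0}" for v
    by (intro closed_Collect_eq coord continuous_on_const)
  moreover have "closed {y :: 'a \<Rightarrow> real. (\<Sum>v\<in>?V. (y v)\<^sup>2) = 1}"
    by (intro closed_Collect_eq continuous_on_sum continuous_on_power coord continuous_on_const)
  ultimately have "closed S" by auto
  moreover have "S \<subseteq> PiE UNIV ?B"
  proof
    fix y assume y: "y \<in> S"
    have "\<bar>y v\<bar> \<le> 1" if "v \<in> ?V" for v
    proof -
      have "(y v)\<^sup>2 \<le> (\<Sum>v\<in>?V. (y v)\<^sup>2)"
        using that fin by (intro member_le_sum) auto
      then have "(y v)\<^sup>2 \<le> 1" using y by (simp add: S_def)
      then show ?thesis by (simp add: abs_square_le_1)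
    qed
    then show "y \<in> PiE UNIV ?B" using y by (fastforce simp: S_def abs_le_iff)
  qed
  ultimately have "compact S" using cB compact_Int_closed[of "PiE UNIV ?B" S] by (simp add: Int_absorb1)
  moreover obtain w where w: "w \<in> ?V" using assms(2) by blast
  have "(\<Sum>v\<in>?V. (if v = w then 1 else 0 :: real)\<^sup>2) = (\<Sum>v\<in>?V. if v = w then 1 else 0)"
    by (intro sum.cong) auto
  then have "(\<lambda>v. if v = w then 1 else 0) \<in> S"
    using w fin by (auto simp: S_def)
  then have "S \<noteq> {}" by blast
  moreover have "continuous_on S (energy G)"
    unfolding energy_def
    by (intro continuous_on_sum continuous_on_power continuous_on_subset[OF coord]) auto
  ultimately obtain x where x: "x \<in> S" "\<And>y. y \<in> S \<Longrightarrow> energy G y \<le> energy G x"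
    using continuous_attains_sup[of S "energy G"] by blast
  let ?x = "\<lambda>v. \<bar>x v\<bar>"
  have xle: "energy G x \<le> energy G ?x"
    unfolding energy_def
  proof (intro sum_mono)
    fix e
    have "\<bar>sum x e\<bar> \<le> sum ?x e" by (rule sum_abs)
    then show "(sum x e)\<^sup>2 \<le> (sum ?x e)\<^sup>2" by (metis abs_ge_zero power2_abs power_mono)
  qed
  show thesis
  proof (rule that)
    show "(\<Sum>v\<in>?V. (?x v)\<^sup>2) = 1" using x(1) by (simp add: S_def)
    fix y :: "'a \<Rightarrow> real"
    let ?N = "\<Sum>v\<in>?V. (y v)\<^sup>2"
    show "energy G y \<le> energy G ?x * ?N"
    proof (cases "?N = 0")
      case True
      then have "y v = 0" if "v \<in> ?V" for v
        using that fin by (auto simp: sum_nonneg_eq_0_iff)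
      then have "energy G y = energy G (\<lambda>v. 0)" by (intro energy_cong[OF assms(1)]) auto
      then show ?thesis using True by (simp add: energy_def)
    next
      case False
      then have N: "?N > 0" by (metis sum_nonneg zero_le_power2 order_less_le)
      define z where "z = (\<lambda>v. if v \<in> ?V then inverse (sqrt ?N) * y v else 0)"
      have "(\<Sum>v\<in>?V. (z v)\<^sup>2) = (\<Sum>v\<in>?V. inverse ?N * (y v)\<^sup>2)"
        using N by (intro sum.cong) (auto simp: z_def power_mult_distrib power_inverse)
      also have "\<dots> = 1" using N by (simp add: sum_distrib_left[symmetric])
      finally have "z \<in> S" by (auto simp: S_def z_def)
      then have "energy G z \<le> energy G ?x" using x(2) xle by fastforce
      moreover have "energy G z = energy G (\<lambda>v. inverse (sqrt ?N) * y v)"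
        by (intro energy_cong[OF assms(1)]) (simp add: z_def)
      moreover have "\<dots> = inverse ?N * energy G y"
        using N unfolding energy_scale by (simp add: power_inverse)
      ultimately have "inverse ?N * energy G y \<le> energy G ?x" by linarith
      then have "?N * (inverse ?N * energy G y) \<le> ?N * energy G ?x"
        using N by (intro mult_left_mono) auto
      moreover have "?N * (inverse ?N * energy G y) = energy G y"
        by (simp only: mult.assoc[symmetric] right_inverse[OF False] mult_1_left)
      ultimately show ?thesis by (simp only: mult.commute)
    qed
  qed auto
qed

lemma quadratic_nonpos_imp_linear_zero:
  fixes a b :: real
  assumes "\<And>t. 2 * t * a + t\<^sup>2 * b \<le> 0"
  shows "a = 0"
proof (rule ccontr)
  assume a: "a \<noteq> 0"
  \<comment> \<open>At a small multiple of \<open>a\<close> the linear term outweighs the quadratic one.\<close>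
  define s where "s = 1 / (\<bar>b\<bar> + 1)"
  have s: "s > 0" "\<bar>s * b\<bar> \<le> 1" by (auto simp: s_def abs_mult divide_simps)
  have "2 * (s * a) * a + (s * a)\<^sup>2 * b = s * a\<^sup>2 * (2 + s * b)"
    by (simp add: power2_eq_square algebra_simps)
  moreover have "s * a\<^sup>2 * (2 + s * b) > 0"
    using s a by (intro mult_pos_pos) (auto simp: abs_le_iff)
  ultimately show False using assms[of "s * a"] by linarith
qed

text \<open>The difference of the two sides of \<open>le\<close> is a quadratic polynomial along each coordinate direction and
  attains its maximum at \<open>x\<close>, so its linear part vanishes there.\<close>

lemma maximiser_eigenfunction:
  assumes G: "simple_graph G"
    and le: "\<And>y. energy G y \<le> m * (\<Sum>v\<in>verts G. (y v)\<^sup>2)"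
    and eq: "energy G x = m * (\<Sum>v\<in>verts G. (x v)\<^sup>2)"
    and w: "w \<in> verts G"
  shows "laplace G x w = m * x w"
proof -
  note fin = simple_graph_finite[OF G]
  let ?d = "\<lambda>v. if v = w then 1 else 0 :: real"
  have dsum: "(\<Sum>v\<in>verts G. ?d v * f v) = f w" for f
    using w fin by (simp add: if_distrib[of "\<lambda>a. a * _"] cong: if_cong)
  have "2 * t * (laplace G x w - m * x w) + t\<^sup>2 * (energy G ?d - m) \<le> 0" for t
  proof -
    let ?y = "\<lambda>v. x v + t * ?d v"
    have "energy G ?y = (\<Sum>e\<in>edges G. (sum x e)\<^sup>2 + 2 * t * (sum ?d e * sum x e) + t\<^sup>2 * (sum ?d e)\<^sup>2)"
      unfolding energy_def
      by (intro sum.cong refl) (simp only: sum.distrib sum_distrib_left[symmetric], simp add: power2_eq_square algebra_simps)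
    also have "\<dots> = energy G x + 2 * t * (\<Sum>e\<in>edges G. sum ?d e * sum x e) + t\<^sup>2 * energy G ?d"
      by (simp only: energy_def sum.distrib sum_distrib_left)
    also have "(\<Sum>e\<in>edges G. sum ?d e * sum x e) = laplace G x w"
      using laplace_bilinear[OF G, of ?d x] dsum by simp
    finally have 1: "energy G ?y = energy G x + 2 * t * laplace G x w + t\<^sup>2 * energy G ?d" .
    have "(\<Sum>v\<in>verts G. (?y v)\<^sup>2) =
        (\<Sum>v\<in>verts G. (x v)\<^sup>2 + 2 * t * (?d v * x v) + t\<^sup>2 * (?d v * 1))"
      by (intro sum.cong refl) (simp add: power2_eq_square algebra_simps)
    also have "\<dots> = (\<Sum>v\<in>verts G. (x v)\<^sup>2) + 2 * t * x w + t\<^sup>2"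
      using dsum[of "\<lambda>_. 1"] by (simp only: sum.distrib sum_distrib_left[symmetric] dsum mult_1_right)
    finally have 2: "(\<Sum>v\<in>verts G. (?y v)\<^sup>2) = (\<Sum>v\<in>verts G. (x v)\<^sup>2) + 2 * t * x w + t\<^sup>2" .
    from le[of ?y] show ?thesis unfolding 1 2 eq by (simp add: algebra_simps)
  qed
  then show ?thesis using quadratic_nonpos_imp_linear_zero by fastforce
qed

section \<open>The largest eigenvalue\<close>

text \<open>Functions on the vertices replace coordinate vectors here, which removes the chosen enumeration
  from everything that follows.\<close>

lemma eigenvalue_signless_laplacian_iff:
  assumes G: "simple_graph G" and vs: "distinct vs" "set vs = verts G"
  shows "eigenvalue (signless_laplacian G vs) k \<longleftrightarrow>
    (\<exists>x. (\<exists>v\<in>verts G. x v \<noteq> 0) \<and> (\<forall>v\<in>verts G. laplace G x v = k * x v))"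
proof -
  let ?n = "length vs" and ?A = "signless_laplacian G vs"
  have dim: "dim_row ?A = ?n" "dim_col ?A = ?n"
    by (simp_all add: signless_laplacian_def degree_matrix_def adjacency_matrix_def)
  have bij: "bij_betw ((!) vs) {..<?n} (verts G)" using vs by (metis bij_betw_nth)
  have entry: "?A $$ (i, j) = (if i = j then real (card (nbrs G (vs ! i))) else 0) +
      (if {vs ! i, vs ! j} \<in> edges G then 1 else 0)" if "i < ?n" "j < ?n" for i j
    using that by (simp add: signless_laplacian_def degree_matrix_def adjacency_matrix_def vertex_degree_nbrs)
  have mult: "vec_index (?A *\<^sub>v Matrix.vec ?n (\<lambda>i. x (vs ! i))) i = laplace G x (vs ! i)" if i: "i < ?n" for x i
  proof -
    have "vec_index (?A *\<^sub>v Matrix.vec ?n (\<lambda>i. x (vs ! i))) i = (\<Sum>j<?n. ?A $$ (i, j) * x (vs ! j))"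
      using i dim by (simp add: scalar_prod_def atLeast0LessThan)
    also have "\<dots> = (\<Sum>j<?n. (if i = j then real (card (nbrs G (vs ! i))) * x (vs ! j) else 0) +
        (if {vs ! i, vs ! j} \<in> edges G then x (vs ! j) else 0))"
      using i by (intro sum.cong refl) (simp add: entry distrib_right)
    also have "\<dots> = real (card (nbrs G (vs ! i))) * x (vs ! i) +
        (\<Sum>j<?n. if {vs ! i, vs ! j} \<in> edges G then x (vs ! j) else 0)"
      using i by (simp add: sum.distrib)
    also have "(\<Sum>j<?n. if {vs ! i, vs ! j} \<in> edges G then x (vs ! j) else 0) =
        (\<Sum>u\<in>verts G. if {vs ! i, u} \<in> edges G then x u else 0)"
      by (rule sum.reindex_bij_betw[OF bij])
    also have "\<dots> = (\<Sum>u\<in>nbrs G (vs ! i). x u)"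
      using simple_graph_finite(1)[OF G] by (simp add: nbrs_def sum.inter_filter)
    finally show ?thesis using laplace_nbrs[OF G] by simp
  qed
  show ?thesis
  proof
    assume "eigenvalue ?A k"
    then obtain w where w: "w \<in> carrier_vec ?n" "w \<noteq> 0\<^sub>v ?n" "?A *\<^sub>v w = k \<cdot>\<^sub>v w"
      by (auto simp: eigenvalue_def eigenvector_def dim)
    define x where "x v = vec_index w (the_inv_into {..<?n} ((!) vs) v)" for v
    have x: "x (vs ! i) = vec_index w i" if "i < ?n" for i
      using that bij by (simp add: x_def bij_betw_def the_inv_into_f_f)
    have wx: "w = Matrix.vec ?n (\<lambda>i. x (vs ! i))" using w(1) x by (intro eq_vecI) auto
    have "laplace G x v = k * x v" if v: "v \<in> verts G" for v
    proof -
      obtain i where i: "i < ?n" "v = vs ! i" using v vs(2) by (metis in_set_conv_nth)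
      have "laplace G x v = vec_index (?A *\<^sub>v w) i" using mult[OF i(1), of x] i wx by simp
      then show ?thesis using w i x by simp
    qed
    moreover have "\<exists>v\<in>verts G. x v \<noteq> 0"
    proof (rule ccontr)
      assume "\<not> ?thesis"
      then have "w = 0\<^sub>v ?n" using vs w(1) x by (intro eq_vecI) (auto, metis nth_mem)
      then show False using w by simp
    qed
    ultimately show "\<exists>x. (\<exists>v\<in>verts G. x v \<noteq> 0) \<and> (\<forall>v\<in>verts G. laplace G x v = k * x v)" by blast
  next
    assume "\<exists>x. (\<exists>v\<in>verts G. x v \<noteq> 0) \<and> (\<forall>v\<in>verts G. laplace G x v = k * x v)"
    then obtain x where x: "\<exists>v\<in>verts G. x v \<noteq> 0" "\<forall>v\<in>verts G. laplace G x v = k * x v" by blast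
    let ?w = "Matrix.vec ?n (\<lambda>i. x (vs ! i))"
    obtain i where i: "i < ?n" "x (vs ! i) \<noteq> 0" using x(1) vs(2) by (metis in_set_conv_nth)
    then have "?w \<noteq> 0\<^sub>v ?n" by (metis index_vec index_zero_vec(1))
    moreover have "?A *\<^sub>v ?w = k \<cdot>\<^sub>v ?w"
      using x(2) vs(2) dim mult by (intro eq_vecI) (auto)
    ultimately show "eigenvalue ?A k"
      unfolding eigenvalue_def eigenvector_def using dim by (intro exI[of _ ?w]) auto
  qed
qed

lemma finite_eigenvalues:
  fixes A :: "'b :: field mat"
  assumes "A \<in> carrier_mat n n"
  shows "finite {k. eigenvalue A k}"
proof -
  have "char_poly A \<noteq> 0" using degree_monic_char_poly[OF assms] by auto
  then show ?thesis using poly_roots_finite by (simp add: eigenvalue_root_char_poly[OF assms])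
qed

text \<open>A maximiser of the Rayleigh quotient is an eigenfunction, and the quotient of any eigenfunction is
  its eigenvalue, so the largest eigenvalue is the maximum.\<close>

lemma q_index_variational:
  assumes G: "simple_graph G" and ne: "verts G \<noteq> {}"
  shows "energy G y \<le> q_index G * (\<Sum>v\<in>verts G. (y v)\<^sup>2)"
    and "\<exists>x. (\<forall>v. 0 \<le> x v) \<and> (\<Sum>v\<in>verts G. (x v)\<^sup>2) = 1 \<and>
      (\<forall>v\<in>verts G. laplace G x v = q_index G * x v)"
proof -
  note fin = simple_graph_finite[OF G]
  obtain x where x: "\<And>v. 0 \<le> x v" "(\<Sum>v\<in>verts G. (x v)\<^sup>2) = 1"
    and max: "\<And>y. energy G y \<le> energy G x * (\<Sum>v\<in>verts G. (y v)\<^sup>2)"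
    using energy_maximiser[OF assms] by metis
  have eig: "laplace G x v = energy G x * x v" if "v \<in> verts G" for v
    using maximiser_eigenfunction[OF G max _ that] x(2) by simp
  define vs where "vs = (SOME vs. distinct vs \<and> set vs = verts G)"
  have vs: "distinct vs" "set vs = verts G"
    using someI_ex[of "\<lambda>vs. distinct vs \<and> set vs = verts G"] finite_distinct_list[OF fin(1)]
    unfolding vs_def by blast+
  note iff = eigenvalue_signless_laplacian_iff[OF G vs]
  have "Max {k. eigenvalue (signless_laplacian G vs) k} = energy G x"
  proof (rule Max_eqI)
    have "signless_laplacian G vs \<in> carrier_mat (length vs) (length vs)"
      by (simp add: signless_laplacian_def degree_matrix_def adjacency_matrix_def)
    then show "finite {k. eigenvalue (signless_laplacian G vs) k}" by (rule finite_eigenvalues)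
    have "\<exists>v\<in>verts G. x v \<noteq> 0" using x(2) by (metis sum.neutral zero_neq_one zero_power2)
    then show "energy G x \<in> {k. eigenvalue (signless_laplacian G vs) k}" using eig iff by blast
    fix k assume "k \<in> {k. eigenvalue (signless_laplacian G vs) k}"
    then obtain z where z: "\<exists>v\<in>verts G. z v \<noteq> 0" "\<forall>v\<in>verts G. laplace G z v = k * z v"
      using iff by blast
    have "energy G z = (\<Sum>v\<in>verts G. k * (z v)\<^sup>2)"
      unfolding energy_laplace[OF G] using z(2) by (intro sum.cong) (auto simp: power2_eq_square)
    then have "k * (\<Sum>v\<in>verts G. (z v)\<^sup>2) \<le> energy G x * (\<Sum>v\<in>verts G. (z v)\<^sup>2)"
      using max[of z] by (simp add: sum_distrib_left)
    moreover have "(\<Sum>v\<in>verts G. (z v)\<^sup>2) > 0"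
      using z(1) fin(1) by (metis sum_pos2 zero_le_power2 zero_less_power2)
    ultimately show "k \<le> energy G x" by simp
  qed
  then have q: "q_index G = energy G x" by (simp add: q_index_def vs_def Let_def)
  show "energy G y \<le> q_index G * (\<Sum>v\<in>verts G. (y v)\<^sup>2)" using max q by simp
  show "\<exists>x. (\<forall>v. 0 \<le> x v) \<and> (\<Sum>v\<in>verts G. (x v)\<^sup>2) = 1 \<and>
      (\<forall>v\<in>verts G. laplace G x v = q_index G * x v)"
    using x eig q by auto
qed

lemma q_index_greater:
  assumes "simple_graph G" "verts G \<noteq> {}" "k * (\<Sum>v\<in>verts G. (y v)\<^sup>2) < energy G y"
  shows "k < q_index G"
proof -
  have "k * (\<Sum>v\<in>verts G. (y v)\<^sup>2) < q_index G * (\<Sum>v\<in>verts G. (y v)\<^sup>2)"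
    using assms q_index_variational(1)[of G y] by linarith
  moreover have "(\<Sum>v\<in>verts G. (y v)\<^sup>2) \<ge> 0" by (simp add: sum_nonneg)
  ultimately show ?thesis by (simp add: mult_less_cancel_right)
qed

text \<open>Pair the weights with a nonnegative eigenfunction and use that the form is symmetric.\<close>

lemma q_index_le_weights:
  assumes G: "simple_graph G" and ne: "verts G \<noteq> {}"
    and pos: "\<And>v. v \<in> verts G \<Longrightarrow> y v > 0"
    and le: "\<And>v. v \<in> verts G \<Longrightarrow> laplace G y v \<le> k * y v"
  shows "q_index G \<le> k"
proof -
  note fin = simple_graph_finite[OF G]
  obtain x where x: "\<And>v. 0 \<le> x v" "(\<Sum>v\<in>verts G. (x v)\<^sup>2) = 1"
      "\<And>v. v \<in> verts G \<Longrightarrow> laplace G x v = q_index G * x v"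
    using q_index_variational(2)[OF G ne] by blast
  let ?s = "\<Sum>v\<in>verts G. x v * y v"
  have "q_index G * ?s = (\<Sum>v\<in>verts G. y v * laplace G x v)"
    using x(3) by (simp add: sum_distrib_left algebra_simps)
  also have "\<dots> = (\<Sum>v\<in>verts G. x v * laplace G y v)"
    by (simp add: laplace_bilinear[OF G] mult.commute)
  also have "\<dots> \<le> (\<Sum>v\<in>verts G. x v * (k * y v))"
    using le x(1) by (intro sum_mono mult_left_mono) auto
  also have "\<dots> = k * ?s" by (simp add: sum_distrib_left algebra_simps)
  finally have "q_index G * ?s \<le> k * ?s" .
  moreover obtain w where "w \<in> verts G" "x w \<noteq> 0"
    using x(2) by (metis sum.neutral zero_neq_one zero_power2)
  then have "?s > 0"
    using fin x(1) pos by (intro sum_pos2[of _ w]) (auto simp: order_less_le)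
  ultimately show ?thesis by simp
qed

text \<open>At a zero of a nonnegative eigenfunction all sums over incident edges vanish.  A zero anywhere would
  therefore spread to \<open>h\<close> and from there to all vertices.  So the eigenfunction is positive, and
  each new edge adds to its energy.\<close>

lemma q_index_strict_mono_dominated:
  assumes G: "simple_graph G" and F: "simple_graph F" and V: "verts F = verts G"
    and E: "edges G \<subset> edges F"
    and h: "h \<in> verts G" "\<And>u. u \<in> verts G \<Longrightarrow> u \<noteq> h \<Longrightarrow> {h, u} \<in> edges G"
  shows "q_index G < q_index F"
proof -
  note fin = simple_graph_finite[OF G]
  have ne: "verts G \<noteq> {}" using h by blast
  obtain x where x: "\<And>v. 0 \<le> x v" "(\<Sum>v\<in>verts G. (x v)\<^sup>2) = 1"
      "\<And>v. v \<in> verts G \<Longrightarrow> laplace G x v = q_index G * x v"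
    using q_index_variational(2)[OF G ne] by blast
  have zero: "sum x e = 0" if "v \<in> verts G" "x v = 0" "e \<in> edges G" "v \<in> e" for v e
  proof -
    have "laplace G x v = 0" using that x(3) by simp
    then show ?thesis
      using that fin x(1) unfolding laplace_def by (subst (asm) sum_nonneg_eq_0_iff) (auto intro: sum_nonneg)
  qed
  have star: "x h = 0 \<and> x u = 0" if "u \<in> verts G" "u \<noteq> h" "x u = 0 \<or> x h = 0" for u
  proof -
    have "sum x {h, u} = 0" using zero[of u "{h, u}"] zero[of h "{h, u}"] that h by auto
    then show ?thesis using that x(1)[of u] x(1)[of h] by (simp add: add_nonneg_eq_0_iff)
  qed
  have pos: "x v > 0" if "v \<in> verts G" for v
  proof (rule ccontr)
    assume "\<not> x v > 0"
    then have "x v = 0" using x(1)[of v] by simp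
    then have "x h = 0" using star[OF that] by blast
    then have "x u = 0" if "u \<in> verts G" for u using star[OF that] by blast
    then have "(\<Sum>v\<in>verts G. (x v)\<^sup>2) = 0" by simp
    then show False using x(2) by simp
  qed
  have "energy G x = (\<Sum>v\<in>verts G. q_index G * (x v)\<^sup>2)"
    unfolding energy_laplace[OF G] using x(3) by (intro sum.cong) (auto simp: power2_eq_square)
  then have "q_index G = energy G x" using x(2) by (simp add: sum_distrib_left[symmetric])
  also have "\<dots> < energy F x"
  proof -
    obtain e where e: "e \<in> edges F" "e \<notin> edges G" using E by blast
    then have "e \<noteq> {}" "e \<subseteq> verts G" using F V by (auto simp: simple_graph_def)
    then have "sum x e > 0" using pos finite_subset[OF _ fin(1)] by (intro sum_pos) auto
    then have "(sum x e)\<^sup>2 > 0" by simp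
    then show ?thesis
      unfolding energy_def using e E simple_graph_finite(2)[OF F]
      by (intro sum_strict_mono2[of _ _ e]) auto
  qed
  also have "\<dots> \<le> q_index F" using q_index_variational(1)[OF F, of x] V ne x(2) by simp
  finally show ?thesis .
qed

lemma iso_image_edges:
  assumes G: "simple_graph G" and H: "simple_graph H"
    and f: "bij_betw f (verts G) (verts H)"
    and E: "\<And>u v. u \<in> verts G \<Longrightarrow> v \<in> verts G \<Longrightarrow> {u, v} \<in> edges G \<longleftrightarrow> {f u, f v} \<in> edges H"
  shows "bij_betw ((`) f) (edges G) (edges H)"
  unfolding bij_betw_def
proof
  have "inj_on ((`) f) (Pow (verts G))" using f by (simp add: bij_betw_def inj_on_image_Pow)
  then show "inj_on ((`) f) (edges G)"
    by (rule inj_on_subset) (use G in \<open>auto simp: simple_graph_def\<close>)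
  show "(`) f ` edges G = edges H"
  proof
    show "(`) f ` edges G \<subseteq> edges H"
    proof clarify
      fix e assume e: "e \<in> edges G"
      obtain u v where "e = {u, v}" "u \<in> verts G" "v \<in> verts G" by (rule edge_cases[OF G e])
      then show "f ` e \<in> edges H" using e E by simp
    qed
    show "edges H \<subseteq> (`) f ` edges G"
    proof
      fix e assume e: "e \<in> edges H"
      obtain a b where ab: "e = {a, b}" "a \<in> verts H" "b \<in> verts H" by (rule edge_cases[OF H e])
      moreover have "verts H = f ` verts G" using f by (simp add: bij_betw_def)
      ultimately obtain u v where "a = f u" "b = f v" "u \<in> verts G" "v \<in> verts G"
        by blast
      then show "e \<in> (`) f ` edges G" using E e ab by (intro image_eqI[of _ _ "{u, v}"]) auto
    qed
  qed
qed

lemma iso_energy: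
  assumes G: "simple_graph G" and H: "simple_graph H"
    and f: "bij_betw f (verts G) (verts H)"
    and E: "\<And>u v. u \<in> verts G \<Longrightarrow> v \<in> verts G \<Longrightarrow> {u, v} \<in> edges G \<longleftrightarrow> {f u, f v} \<in> edges H"
  shows "energy G (x \<circ> f) = energy H x"
proof -
  have "sum (x \<circ> f) e = sum x (f ` e)" if "e \<in> edges G" for e
  proof (rule sum.reindex[symmetric])
    show "inj_on f e" using that G f by (auto simp: simple_graph_def bij_betw_def intro: inj_on_subset)
  qed
  then have "energy G (x \<circ> f) = (\<Sum>e\<in>edges G. (sum x (f ` e))\<^sup>2)"
    by (simp add: energy_def)
  also have "\<dots> = energy H x"
    unfolding energy_def by (rule sum.reindex_bij_betw[OF iso_image_edges[OF assms]])
  finally show ?thesis .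
qed

lemma graph_iso_sym:
  assumes "G \<cong>\<^sub>g H"
  shows "H \<cong>\<^sub>g G"
proof -
  obtain f where f: "bij_betw f (verts G) (verts H)"
    "\<forall>u\<in>verts G. \<forall>v\<in>verts G. {u, v} \<in> edges G \<longleftrightarrow> {f u, f v} \<in> edges H"
    using assms by (auto simp: graph_iso_def)
  let ?g = "the_inv_into (verts G) f"
  have "f (?g v) = v \<and> ?g v \<in> verts G" if "v \<in> verts H" for v
    using that f(1) by (metis bij_betw_def f_the_inv_into_f the_inv_into_into subset_refl)
  then show ?thesis
    unfolding graph_iso_def using f bij_betw_the_inv_into[OF f(1)] by (intro exI[of _ ?g]) auto
qed

lemma q_index_iso:
  assumes G: "simple_graph G" and H: "simple_graph H" and ne: "verts G \<noteq> {}" and iso: "G \<cong>\<^sub>g H"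
  shows "q_index G = q_index H"
proof -
  have le: "q_index B \<le> q_index A"
    if A: "simple_graph A" "verts A \<noteq> {}" and B: "simple_graph B" and iso: "A \<cong>\<^sub>g B"
    for A :: "'c graph" and B :: "'d graph"
  proof -
    obtain f where f: "bij_betw f (verts A) (verts B)"
      "\<And>u v. u \<in> verts A \<Longrightarrow> v \<in> verts A \<Longrightarrow> {u, v} \<in> edges A \<longleftrightarrow> {f u, f v} \<in> edges B"
      using iso by (auto simp: graph_iso_def)
    have "verts B \<noteq> {}" using f(1) A by (auto simp: bij_betw_def)
    then obtain x where x: "(\<Sum>v\<in>verts B. (x v)\<^sup>2) = 1" 
        "\<And>v. v \<in> verts B \<Longrightarrow> laplace B x v = q_index B * x v"
      using q_index_variational(2)[OF B] by blast
    have "energy B x = (\<Sum>v\<in>verts B. q_index B * (x v)\<^sup>2)"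
      unfolding energy_laplace[OF B] using x(2) by (intro sum.cong) (auto simp: power2_eq_square)
    then have "q_index B = energy A (x \<circ> f)"
      using x(1) iso_energy[OF A(1) B f] by (simp add: sum_distrib_left[symmetric])
    also have "\<dots> \<le> q_index A * (\<Sum>v\<in>verts A. ((x \<circ> f) v)\<^sup>2)"
      by (rule q_index_variational(1)[OF A])
    also have "(\<Sum>v\<in>verts A. ((x \<circ> f) v)\<^sup>2) = 1"
      using x(1) sum.reindex_bij_betw[OF f(1), of "\<lambda>v. (x v)\<^sup>2"] by simp
    finally show ?thesis by simp
  qed
  have "verts H \<noteq> {}" using iso ne by (auto simp: graph_iso_def bij_betw_def)
  then show ?thesis using le[OF G ne H iso] le[OF H _ G graph_iso_sym[OF iso]] by linarith
qed

section \<open>Neighbourhoods in outerplanar graphs\<close>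

lemma path_edges_hd: 
  assumes "{x, y} \<in> path_edges (x # vs)" "x \<notin> set vs"
  shows "vs \<noteq> [] \<and> y = hd vs"
  using assms path_edges_subset[of "{x, y}" vs] by (cases vs) (auto simp: doubleton_eq_iff)

text \<open>An edge from the start of a longest path to a new vertex would extend the path, and one back into
  the path, other than to the next vertex, would close a cycle.\<close>

lemma longest_path_start:
  assumes acyclic: "\<And>rs. distinct rs \<Longrightarrow> set rs \<subseteq> N \<Longrightarrow> length rs \<ge> 3 \<Longrightarrow> path_edges rs \<subseteq> E \<Longrightarrow>
      {last rs, hd rs} \<notin> E"
    and rs: "distinct (u # rs)" "set (u # rs) \<subseteq> N" "path_edges (u # rs) \<subseteq> E"
    and longest: "\<And>qs. distinct qs \<Longrightarrow> set qs \<subseteq> N \<Longrightarrow> path_edges qs \<subseteq> E \<Longrightarrow>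
      length qs \<le> length (u # rs)"
    and e: "{u, w} \<in> E" "u \<noteq> w" "w \<in> N"
  shows "{u, w} \<in> path_edges (u # rs)"
proof (cases "w \<in> set rs")
  case False
  have "path_edges (w # u # rs) \<subseteq> E" using rs(3) e(1) by (simp add: insert_commute)
  then have "length (w # u # rs) \<le> length (u # rs)"
    using rs e False by (intro longest) auto
  then show ?thesis by simp
next
  case True
  then obtain xs ys where s: "rs = xs @ w # ys" by (meson split_list)
  show ?thesis
  proof (cases "xs = []")
    case True
    then show ?thesis using s by simp
  next
    case False
    let ?c = "(u # xs) @ [w]"
    have "path_edges ?c \<subseteq> E" using rs(3) path_edges_append[of "u # xs" w ys] by (simp add: s)
    then have "{last ?c, hd ?c} \<notin> E"
      using False rs by (intro acyclic) (auto simp: s Suc_le_eq)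
    then show ?thesis using e by (simp add: insert_commute)
  qed
qed

text \<open>A graph of maximal degree two without cycles is a disjoint union of paths.  A longest path splits
  off: its ends have no further edges by the previous lemma, and its inner vertices have already spent
  their degree of two.\<close>

lemma linear_forest_enumeration:
  assumes "finite N"
    and "\<And>u. u \<in> N \<Longrightarrow> card {w \<in> N. {u, w} \<in> E} \<le> 2"
    and "\<And>rs. distinct rs \<Longrightarrow> set rs \<subseteq> N \<Longrightarrow> length rs \<ge> 3 \<Longrightarrow> path_edges rs \<subseteq> E \<Longrightarrow>
      {last rs, hd rs} \<notin> E"
  shows "\<exists>ps. distinct ps \<and> set ps = N \<and>
    (\<forall>u\<in>N. \<forall>w\<in>N. u \<noteq> w \<longrightarrow> {u, w} \<in> E \<longrightarrow> {u, w} \<in> path_edges ps)"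
  using assms
proof (induction N rule: finite_psubset_induct)
  case (psubset N)
  show ?case
  proof (cases "N = {}")
    case True
    then show ?thesis by (intro exI[of _ "[]"]) auto
  next
    case False
    then obtain a where a: "a \<in> N" by blast
    let ?P = "\<lambda>rs. distinct rs \<and> set rs \<subseteq> N \<and> path_edges rs \<subseteq> E"
    have "length rs \<le> card N" if "?P rs" for rs
      using that psubset(1) by (metis card_mono distinct_card)
    then obtain rs where rs: "?P rs" and longest: "\<And>qs. ?P qs \<Longrightarrow> length qs \<le> length rs"
      using ex_has_greatest_nat[of ?P "[a]" length "Suc (card N)"] a by fastforce
    have "length [a] \<le> length rs" by (rule longest) (use a in auto)
    then have ne: "rs \<noteq> []" by auto
    have start: "{hd qs, w} \<in> path_edges qs"
      if "?P qs" "length qs = length rs" "w \<in> N" "hd qs \<noteq> w" "{hd qs, w} \<in> E" for qs w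
    proof -
      have "qs \<noteq> []" using that ne by auto
      then obtain u us where qs: "qs = u # us" by (cases qs) auto
      show ?thesis unfolding qs list.sel
        by (rule longest_path_start[OF psubset.prems(2)]) (use that qs longest in auto)
    qed
    have closed: "{u, w} \<in> path_edges rs"
      if u: "u \<in> set rs" and w: "w \<in> N" "u \<noteq> w" "{u, w} \<in> E" for u w
    proof -
      consider "u = hd rs" | "u = last rs" | xs x y ys where "rs = xs @ x # u # y # ys"
      proof -
        obtain xs ys where s: "rs = xs @ u # ys" using u by (meson split_list)
        show thesis
        proof (cases "xs = [] \<or> ys = []")
          case True
          then show thesis using that(1,2) s by auto
        next
          case False
          then obtain xs' x y ys' where "xs = xs' @ [x]" "ys = y # ys'"
            by (metis append_butlast_last_id list.exhaust)
          then show thesis using that(3) s by simp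
        qed
      qed
      then show ?thesis
      proof cases
        case 1
        then show ?thesis using start[of rs w] rs w by simp
      next
        case 2
        then show ?thesis
          using start[of "rev rs" w] rs w by (simp add: path_edges_rev hd_rev)
      next
        case 3
        have pe: "{x, u} \<in> path_edges rs" "{u, y} \<in> path_edges rs"
          using path_edges_append[of xs x "u # y # ys"] by (simp_all add: 3)
        have "w \<in> {x, y}"
        proof (rule ccontr)
          assume nw: "w \<notin> {x, y}"
          have "{x, y, w} \<subseteq> {w \<in> N. {u, w} \<in> E}"
            using pe rs w 3 by (auto simp: insert_commute)
          then have "card {x, y, w} \<le> card {w \<in> N. {u, w} \<in> E}"
            using psubset(1) by (intro card_mono) auto
          moreover have "card {x, y, w} = 3" using nw rs 3 by auto
          ultimately show False using psubset.prems(1)[of u] rs u by fastforce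
        qed
        then show ?thesis using pe by (auto simp: insert_commute)
      qed
    qed
    let ?M = "N - set rs"
    have "?M \<subset> N" using ne rs by (cases rs) auto
    moreover have "card {w \<in> ?M. {u, w} \<in> E} \<le> 2" if "u \<in> ?M" for u
    proof -
      have "card {w \<in> ?M. {u, w} \<in> E} \<le> card {w \<in> N. {u, w} \<in> E}"
        using psubset(1) by (intro card_mono) auto
      then show ?thesis using psubset.prems(1)[of u] that by simp
    qed
    moreover have "{last qs, hd qs} \<notin> E"
      if "distinct qs" "set qs \<subseteq> ?M" "length qs \<ge> 3" "path_edges qs \<subseteq> E" for qs
      using that by (intro psubset.prems(2)) auto
    ultimately obtain qs where qs: "distinct qs" "set qs = ?M"
      "\<forall>u\<in>?M. \<forall>w\<in>?M. u \<noteq> w \<longrightarrow> {u, w} \<in> E \<longrightarrow> {u, w} \<in> path_edges qs"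
      using psubset.IH[of ?M] by blast
    have sub: "path_edges rs \<union> path_edges qs \<subseteq> path_edges (rs @ qs)"
    proof (cases qs)
      case (Cons q qs')
      have "path_edges rs \<subseteq> path_edges (rs @ [q])"
        using ne by (metis Un_upper1 append.assoc append_Cons append_Nil append_butlast_last_id path_edges_append)
      then show ?thesis using path_edges_append[of rs q qs'] Cons by auto
    qed auto
    show ?thesis
    proof (intro exI[of _ "rs @ qs"] conjI ballI impI)
      fix u w assume uw: "u \<in> N" "w \<in> N" "u \<noteq> w" "{u, w} \<in> E"
      show "{u, w} \<in> path_edges (rs @ qs)"
      proof (cases "u \<in> set rs \<or> w \<in> set rs")
        case True
        then have "{u, w} \<in> path_edges rs"
          using closed[of u w] closed[of w u] uw by (auto simp: insert_commute)
        then show ?thesis using sub by blast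
      next
        case False
        then show ?thesis using qs(3) uw sub by blast
      qed
    qed (use rs qs in auto)
  qed
qed

text \<open>Everything that the eigenvalue estimates need from outerplanarity.\<close>

locale sparse_neighbourhoods =
  fixes G :: "'a graph"
  assumes simple: "simple_graph G"
    and common_nbrs: "u \<noteq> w \<Longrightarrow> card (nbrs G u \<inter> nbrs G w) \<le> 2"
    and nbrs_path: "\<exists>ps. distinct ps \<and> set ps = nbrs G v \<and>
      (\<forall>e\<in>edges G. e \<subseteq> nbrs G v \<longrightarrow> e \<in> path_edges ps)"

lemma outerplanar_sparse_neighbourhoods:
  assumes G: "simple_graph G" and outer: "outerplanar G"
  shows "sparse_neighbourhoods G"
proof -
  obtain p c where "outer_drawing G p c"
    using assms unfolding outerplanar_def outer_drawing_def by blast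
  then interpret outer_drawing G p c .
  note iff = nbrs_iff[OF G]
  have common: "card (nbrs G u \<inter> nbrs G w) \<le> 2" if "u \<noteq> w" for u w
  proof (rule ccontr)
    assume "\<not> ?thesis"
    then have "3 \<le> card (nbrs G u \<inter> nbrs G w)" by simp
    then obtain T where "T \<subseteq> nbrs G u \<inter> nbrs G w" "card T = 3"
      by (metis obtain_subset_with_card_n)
    then obtain x y z where xyz: "x \<noteq> y" "x \<noteq> z" "y \<noteq> z" "{x, y, z} \<subseteq> nbrs G u \<inter> nbrs G w"
      by (auto simp: card_3_iff)
    have "u \<notin> nbrs G u" "w \<notin> nbrs G w" using nbrs_irrefl[OF G] by auto
    then have "distinct [u, w, x, y, z]" using xyz that by auto
    then show False using no_K23[of u w x y z] xyz by (auto simp: iff)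
  qed
  show ?thesis
  proof
    fix v
    let ?N = "nbrs G v"
    have "\<exists>ps. distinct ps \<and> set ps = ?N \<and>
      (\<forall>u\<in>?N. \<forall>w\<in>?N. u \<noteq> w \<longrightarrow> {u, w} \<in> edges G \<longrightarrow> {u, w} \<in> path_edges ps)"
    proof (rule linear_forest_enumeration)
      show "finite ?N" using simple_graph_finite[OF G] by simp
    next
      fix u assume u: "u \<in> ?N"
      then have "u \<noteq> v" using nbrs_irrefl[OF G] by blast
      moreover have "{w \<in> ?N. {u, w} \<in> edges G} = nbrs G u \<inter> ?N" by (auto simp: iff)
      ultimately show "card {w \<in> ?N. {u, w} \<in> edges G} \<le> 2" using common by simp
    next
      fix rs assume rs: "distinct rs" "set rs \<subseteq> ?N" "length rs \<ge> 3" "path_edges rs \<subseteq> edges G"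
      have "distinct (v # rs)" using rs nbrs_irrefl[OF G, of v] by auto
      then show "{last rs, hd rs} \<notin> edges G"
        using no_wheel[of v rs] rs iff by blast
    qed
    then obtain ps where ps: "distinct ps" "set ps = ?N"
      "\<forall>u\<in>?N. \<forall>w\<in>?N. u \<noteq> w \<longrightarrow> {u, w} \<in> edges G \<longrightarrow> {u, w} \<in> path_edges ps"
      by (elim exE conjE) (rule that)
    have "e \<in> path_edges ps" if e: "e \<in> edges G" "e \<subseteq> ?N" for e
    proof -
      obtain u w where uw: "u \<noteq> w" "e = {u, w}" by (rule edge_cases[OF G e(1)])
      then have "u \<in> ?N" "w \<in> ?N" using e(2) by simp_all
      then show ?thesis using ps(3) uw e(1) by simp
    qed
    then show "\<exists>ps. distinct ps \<and> set ps = ?N \<and> (\<forall>e\<in>edges G. e \<subseteq> ?N \<longrightarrow> e \<in> path_edges ps)"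
      using ps by blast
  qed (fact G, rule common)
qed

text \<open>A new first vertex contributes one and raises the contribution of the next vertex by at most one.\<close>

lemma path_degree_sum:
  assumes "distinct ps" "length ps \<ge> 2"
  shows "(\<Sum>u\<in>set ps. max 1 (card {w. {u, w} \<in> path_edges ps})) \<le> 2 * (length ps - 1)"
  using assms
proof (induction ps rule: path_edges.induct)
  case (1 x u vs)
  show ?case
  proof (cases "vs = []")
    case True
    have "{w. {x, w} = {x, u}} = {u}" "{w. {u, w} = {x, u}} = {x}" 
      by (auto simp: doubleton_eq_iff)
    then show ?thesis using 1(2) True by (simp)
  next
    case False
    let ?a = "\<lambda>ps u. card {w. {u, w} \<in> path_edges ps}" and ?ps = "u # vs"
    have fin: "finite {w. {z, w} \<in> path_edges ?ps}" for z
      by (rule finite_subset[of _ "set ?ps"]) (use path_edges_subset[of _ ?ps] in blast, simp)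
    have x: "x \<notin> set ?ps" using 1 by simp
    have "{w. {x, w} \<in> path_edges (x # ?ps)} \<subseteq> {u}"
      using path_edges_hd[of x _ ?ps] x by auto
    then have ax: "?a (x # ?ps) x \<le> 1" using card_mono[of "{u}"] by fastforce
    have "{w. {u, w} \<in> path_edges (x # ?ps)} \<subseteq> insert x {w. {u, w} \<in> path_edges ?ps}"
      by (auto simp: doubleton_eq_iff)
    then have "?a (x # ?ps) u \<le> card (insert x {w. {u, w} \<in> path_edges ?ps})"
      using fin by (intro card_mono) auto
    also have "\<dots> \<le> Suc (?a ?ps u)" by (simp add: card_insert_le_m1 card_insert_if fin)
    finally have au: "max 1 (?a (x # ?ps) u) \<le> max 1 (?a ?ps u) + 1" by simp
    have az: "?a (x # ?ps) z = ?a ?ps z" if "z \<in> set vs" for z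
    proof -
      have "z \<noteq> x" "z \<noteq> u" using that 1(2) by auto
      then have "{w. {z, w} \<in> path_edges (x # ?ps)} = {w. {z, w} \<in> path_edges ?ps}"
        by (auto simp: doubleton_eq_iff)
      then show ?thesis by simp
    qed
    have "(\<Sum>z\<in>set (x # ?ps). max 1 (?a (x # ?ps) z)) =
        max 1 (?a (x # ?ps) x) + (max 1 (?a (x # ?ps) u) + (\<Sum>z\<in>set vs. max 1 (?a (x # ?ps) z)))"
      using 1(2) by simp
    also have "\<dots> \<le> 1 + ((max 1 (?a ?ps u) + 1) + (\<Sum>z\<in>set vs. max 1 (?a ?ps z)))"
      using ax au az by (intro add_mono sum_mono) auto
    also have "\<dots> = 2 + (\<Sum>z\<in>set ?ps. max 1 (?a ?ps z))" using 1(2) by simp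
    also have "\<dots> \<le> 2 + 2 * (length ?ps - 1)"
      using 1 False by (intro add_left_mono 1(1)) (auto simp: Suc_le_eq)
    finally show ?thesis using False by (cases vs) auto
  qed
qed auto

context sparse_neighbourhoods
begin

abbreviation deg :: "'a \<Rightarrow> nat" where "deg v \<equiv> card (nbrs G v)"
abbreviation nverts :: nat where "nverts \<equiv> card (verts G)"

lemmas fin = simple_graph_finite[OF simple]

lemma nbrs_subset: "nbrs G v \<subseteq> verts G"
  by (auto simp: nbrs_def)

lemma deg_less_order: "v \<in> verts G \<Longrightarrow> deg v < nverts"
  using nbrs_subset nbrs_irrefl[OF simple] fin(1) by (metis psubset_card_mono psubsetI)

text \<open>Count the edges at the neighbours of \<open>v\<close>: one each to \<open>v\<close>, those of a linear forest among the
  neighbours, and at most two from every other vertex.  Replacing a degree of one by two costs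
  nothing, since such a neighbour leaves a gap in the forest.\<close>

lemma sum_nbr_degrees:
  assumes v: "v \<in> verts G" and d: "deg v \<ge> 2"
  shows "(\<Sum>u\<in>nbrs G v. max (deg u) 2) + 4 \<le> deg v + 2 * nverts"
proof -
  let ?N = "nbrs G v" and ?W = "verts G - insert v (nbrs G v)"
  obtain ps where ps: "distinct ps" "set ps = ?N" 
    and path: "\<And>e. e \<in> edges G \<Longrightarrow> e \<subseteq> ?N \<Longrightarrow> e \<in> path_edges ps"
    using nbrs_path[of v] by (elim exE conjE) (rule that, auto)
  have len: "length ps = deg v" using ps distinct_card by metis
  have vN: "v \<notin> ?N" using nbrs_irrefl[OF simple] .
  have deg: "max (deg u) 2 \<le> 1 + max 1 (card {w. {u, w} \<in> path_edges ps}) + card (nbrs G u \<inter> ?W)"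
    if u: "u \<in> ?N" for u
  proof -
    have "nbrs G u \<subseteq> {v} \<union> (nbrs G u \<inter> ?N) \<union> (nbrs G u \<inter> ?W)" using nbrs_subset by blast
    then have "deg u \<le> card ({v} \<union> (nbrs G u \<inter> ?N) \<union> (nbrs G u \<inter> ?W))"
      using fin by (intro card_mono) auto
    also have "\<dots> \<le> card {v} + card (nbrs G u \<inter> ?N) + card (nbrs G u \<inter> ?W)"
      using card_Un_le[of "{v} \<union> (nbrs G u \<inter> ?N)" "nbrs G u \<inter> ?W"] card_Un_le[of "{v}" "nbrs G u \<inter> ?N"]
      by linarith
    finally have "deg u \<le> 1 + card (nbrs G u \<inter> ?N) + card (nbrs G u \<inter> ?W)" by simp
    moreover have "card (nbrs G u \<inter> ?N) \<le> card {w. {u, w} \<in> path_edges ps}"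
    proof (rule card_mono)
      show "finite {w. {u, w} \<in> path_edges ps}"
        by (rule finite_subset[of _ "set ps"]) (use path_edges_subset[of _ ps] in blast, simp)
      show "nbrs G u \<inter> ?N \<subseteq> {w. {u, w} \<in> path_edges ps}"
        using path u nbrs_iff[OF simple] by auto
    qed
    moreover have "card {w. {u, w} \<in> path_edges ps} \<le> max 1 (card {w. {u, w} \<in> path_edges ps})"
      "1 \<le> max 1 (card {w. {u, w} \<in> path_edges ps})" by simp_all
    ultimately show ?thesis by (intro max.boundedI) linarith+
  qed
  have "(\<Sum>u\<in>?N. card (nbrs G u \<inter> ?W)) = (\<Sum>u\<in>?N. \<Sum>w | w \<in> ?W \<and> w \<in> nbrs G u. 1)"
    by (intro sum.cong refl) (simp add: Int_def conj_commute)
  also have "\<dots> = (\<Sum>w\<in>?W. \<Sum>u | u \<in> ?N \<and> w \<in> nbrs G u. 1)"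
    using fin by (intro sum.swap_restrict) auto
  also have "\<dots> \<le> (\<Sum>w\<in>?W. 2)"
  proof (rule sum_mono)
    fix w assume "w \<in> ?W"
    then have "w \<noteq> v" by blast
    have "{u. u \<in> ?N \<and> w \<in> nbrs G u} = nbrs G w \<inter> nbrs G v"
      using nbrs_sym[OF simple] by blast
    then show "(\<Sum>u | u \<in> ?N \<and> w \<in> nbrs G u. 1) \<le> (2 :: nat)"
      using common_nbrs[OF \<open>w \<noteq> v\<close>] by simp
  qed
  also have "\<dots> = 2 * (nverts - Suc (deg v))"
    using fin vN v nbrs_subset by (simp add: card_Diff_subset)
  finally have W: "(\<Sum>u\<in>?N. card (nbrs G u \<inter> ?W)) \<le> 2 * (nverts - Suc (deg v))" .
  have "(\<Sum>u\<in>?N. max (deg u) 2) \<le>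
      (\<Sum>u\<in>?N. 1 + max 1 (card {w. {u, w} \<in> path_edges ps}) + card (nbrs G u \<inter> ?W))"
    using deg by (rule sum_mono)
  also have "\<dots> = deg v + (\<Sum>u\<in>?N. max 1 (card {w. {u, w} \<in> path_edges ps})) +
      (\<Sum>u\<in>?N. card (nbrs G u \<inter> ?W))"
    by (simp only: sum.distrib card_eq_sum)
  also have "\<dots> \<le> deg v + 2 * (deg v - 1) + 2 * (nverts - Suc (deg v))"
    using path_degree_sum[OF ps(1)] W d unfolding len ps(2) by (intro add_mono) auto
  finally show ?thesis using d deg_less_order[OF v] by linarith
qed

text \<open>The two neighbourhoods cover at most all vertices and overlap in at most two.\<close>

lemma sum_two_nbr_degrees:
  assumes d: "deg v = 2" and small: "\<And>u. u \<in> verts G \<Longrightarrow> deg u + 2 \<le> nverts" and n: "nverts \<ge> 2"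
  shows "(\<Sum>u\<in>nbrs G v. max (deg u) 2) \<le> nverts + 2"
proof -
  obtain x y where xy: "nbrs G v = {x, y}" "x \<noteq> y" using d by (auto simp: card_2_iff)
  then have V: "x \<in> verts G" "y \<in> verts G" using nbrs_subset[of v] by auto
  have "deg x + deg y = card (nbrs G x \<union> nbrs G y) + card (nbrs G x \<inter> nbrs G y)"
    using fin by (intro card_Un_Int) auto
  also have "\<dots> \<le> nverts + 2"
    using fin nbrs_subset common_nbrs[OF xy(2)] by (intro add_mono card_mono) auto
  finally show ?thesis using xy small[OF V(1)] small[OF V(2)] n by (simp add: max_def)
qed

end

section \<open>Upper bounds when no vertex is adjacent to all others\<close>

context sparse_neighbourhoods
begin

abbreviation dg :: "'a \<Rightarrow> real" where "dg v \<equiv> real (max (deg v) 2)"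

lemma sum_dg: "(\<Sum>u\<in>nbrs G v. dg u) = real (\<Sum>u\<in>nbrs G v. max (deg u) 2)"
  by simp

lemma laplace_deg: "laplace G y v = real (deg v) * y v + (\<Sum>u\<in>nbrs G v. y u)"
  by (rule laplace_nbrs[OF simple])

lemma q_index_le_max_degree:
  assumes ne: "verts G \<noteq> {}" and d: "\<And>v. v \<in> verts G \<Longrightarrow> deg v \<le> d"
  shows "q_index G \<le> 2 * real d"
proof (rule q_index_le_weights[OF simple ne, of "\<lambda>_. 1"])
  fix v assume "v \<in> verts G"
  then show "laplace G (\<lambda>_. 1) v \<le> 2 * real d * 1" using d[of v] by (simp add: laplace_deg)
qed simp

text \<open>The weight of a vertex is its degree, raised to two so that it is positive and fits
  \<open>sum_nbr_degrees\<close>.  The row of a vertex of degree \<open>d \<ge> 3\<close> then gives the bound \<open>d + 1 + (2n - 4) / d\<close>.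
  This is convex in \<open>d\<close>, and \<open>2n \<le> 3m + 4\<close> makes its value at \<open>m\<close>, which is \<open>k\<close>, at least that at three.
  Degree two would give \<open>n + 1\<close> in this way, so it uses the sharper \<open>sum_two_nbr_degrees\<close>, which leads
  to \<open>n / 2 + 3\<close>.\<close>

lemma q_index_le_degree_weights:
  assumes ne: "verts G \<noteq> {}"
    and m: "\<And>v. v \<in> verts G \<Longrightarrow> deg v \<le> m" "3 \<le> m" "m + 2 \<le> nverts" "2 * nverts \<le> 3 * m + 4"
    and k: "k * real m = real m * (real m + 1) + 2 * real nverts - 4" "real nverts + 6 \<le> 2 * k"
  shows "q_index G \<le> k"
proof (rule q_index_le_weights[OF simple ne, of dg])
  fix v assume v: "v \<in> verts G"
  consider "deg v = 0" | "deg v = 1" | "deg v = 2" | "deg v \<ge> 3" by linarith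
  then show "laplace G dg v \<le> k * dg v"
  proof cases
    case 1
    then have "nbrs G v = {}" using fin by simp
    then show ?thesis using 1 k(2) by (simp add: laplace_deg)
  next
    case 2
    then obtain u where u: "nbrs G v = {u}" by (auto simp: card_1_singleton_iff)
    then have "u \<in> verts G" using nbrs_subset[of v] by auto
    then have "dg u \<le> real m" using m(1)[of u] m(2) by simp
    moreover have "real m + 2 \<le> real nverts" using m(3) by linarith
    ultimately have "2 + dg u \<le> k * 2" using k(2) by linarith
    moreover have "laplace G dg v = 2 + dg u" "dg v = 2" using 2 u by (simp_all add: laplace_deg)
    ultimately show ?thesis by (simp only:)
  next
    case 3
    have "(\<Sum>u\<in>nbrs G v. max (deg u) 2) \<le> nverts + 2"
      using 3 m by (intro sum_two_nbr_degrees) force+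
    then have "(\<Sum>u\<in>nbrs G v. dg u) \<le> real nverts + 2" unfolding sum_dg by linarith
    then show ?thesis using 3 k(2) by (simp add: laplace_deg)
  next
    case 4
    let ?d = "real (deg v)" and ?c = "2 * real nverts - 4" and ?m = "real m"
    have "(\<Sum>u\<in>nbrs G v. max (deg u) 2) + 4 \<le> deg v + 2 * nverts"
      using sum_nbr_degrees[OF v] 4 by simp
    then have row: "(\<Sum>u\<in>nbrs G v. dg u) \<le> ?d + ?c" unfolding sum_dg by linarith
    have "?d \<le> ?m" using m(1)[OF v] by simp
    moreover have "?c \<le> ?m * ?d"
    proof -
      have "?c \<le> ?m * 3" using m(4) by linarith
      also have "\<dots> \<le> ?m * ?d" using 4 by (intro mult_left_mono) auto
      finally show ?thesis .
    qed
    ultimately have "(?d - ?m) * (?m * ?d - ?c) \<le> 0" by (intro mult_nonpos_nonneg) auto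
    \<comment> \<open>The defect of the row, as a polynomial in the degree, has the roots \<open>m\<close> and \<open>(2n - 4) / m\<close>.\<close>
    moreover have "?m * (?d * ?d + (?d + ?c) - k * ?d) = (?d - ?m) * (?m * ?d - ?c)"
    proof -
      have "?m * (?d * ?d + (?d + ?c) - k * ?d) = ?m * (?d * ?d + (?d + ?c)) - (k * ?m) * ?d"
        by (simp add: algebra_simps)
      also have "\<dots> = (?d - ?m) * (?m * ?d - ?c)"
        unfolding k(1) by (simp add: algebra_simps)
      finally show ?thesis .
    qed
    ultimately have "?m * (?d * ?d + (?d + ?c) - k * ?d) \<le> 0" by simp
    then have "?d * ?d + (?d + ?c) \<le> k * ?d" using m(2) by (simp add: mult_le_0_iff)
    then show ?thesis using row 4 by (simp add: laplace_deg)
  qed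
qed simp

text \<open>For six vertices the previous weights give only the bound 7, which exceeds the Q-index of the fan.
  Lowering all weights by the same amount enlarges the ratio of those at degrees four and two, and
  the rows still involve only the sum of the neighbours' degrees.  The row of degree four attains
  \<open>41 / 6\<close>.\<close>

lemma q_index_le_six:
  assumes n: "nverts = 6" and d: "\<And>v. v \<in> verts G \<Longrightarrow> deg v \<le> 4"
  shows "q_index G \<le> 41 / 6"
proof (rule q_index_le_weights[OF simple, of "\<lambda>v. 7 * dg v - 4"])
  show "verts G \<noteq> {}" using n by auto
  fix v assume v: "v \<in> verts G"
  have row: "laplace G (\<lambda>v. 7 * dg v - 4) v = real (deg v) * (7 * dg v - 4) +
      7 * (\<Sum>u\<in>nbrs G v. dg u) - 4 * real (deg v)"
    by (simp add: laplace_deg sum_subtractf sum_distrib_left)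
  consider "deg v = 0" | "deg v = 1" | "deg v = 2" | "deg v \<ge> 3" by linarith
  then show "laplace G (\<lambda>v. 7 * dg v - 4) v \<le> 41 / 6 * (7 * dg v - 4)"
  proof cases
    case 1
    then have "nbrs G v = {}" using fin by simp
    then show ?thesis using 1 unfolding row by simp
  next
    case 2
    then obtain u where u: "nbrs G v = {u}" by (auto simp: card_1_singleton_iff)
    then have "u \<in> verts G" using nbrs_subset[of v] by auto
    then have "dg u \<le> 4" using d[of u] by simp
    then show ?thesis using 2 u unfolding row by simp
  next
    case 3
    have "(\<Sum>u\<in>nbrs G v. max (deg u) 2) \<le> nverts + 2"
      using 3 n d by (intro sum_two_nbr_degrees) force+
    then have "(\<Sum>u\<in>nbrs G v. dg u) \<le> 8" unfolding sum_dg using n by linarith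
    then show ?thesis using 3 unfolding row by simp
  next
    case 4
    have "(\<Sum>u\<in>nbrs G v. max (deg u) 2) + 4 \<le> deg v + 2 * nverts"
      using sum_nbr_degrees[OF v] 4 by linarith
    then have "(\<Sum>u\<in>nbrs G v. dg u) \<le> real (deg v) + 8" unfolding sum_dg using n by linarith
    moreover have "deg v = 3 \<or> deg v = 4" using 4 d[OF v] by linarith
    ultimately show ?thesis unfolding row by auto
  qed
qed simp

text \<open>The vertex \<open>h\<close> misses only one other vertex, \<open>w\<close>.  It gets a large weight \<open>M\<close>, its neighbours get weight
  1, or \<open>3 / 2\<close> if they are also adjacent to \<open>w\<close>, and \<open>w\<close> gets \<open>3 / 5\<close>.  At most two vertices are adjacent
  to both \<open>h\<close> and \<open>w\<close>, and two such vertices have no third common neighbour; hence the neighbours of \<open>h\<close>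
  that are adjacent to a given one weigh at most \<open>5 / 2\<close> together.  The row of a neighbour of weight 1
  is then at most \<open>3 + M + 5 / 2\<close>, which suggests \<open>M = k - 11 / 2\<close>.  With this value the second
  condition on \<open>k\<close> is the row of \<open>h\<close>, and the first serves the vertices adjacent to \<open>w\<close>, and \<open>w\<close> itself.\<close>

lemma q_index_le_hub:
  assumes h: "h \<in> verts G" "deg h + 2 = nverts"
    and k: "36 / 5 \<le> k"
      "real nverts - 1 \<le> (k - real nverts + 2) * (k - 11 / 2)"
  shows "q_index G \<le> k"
proof -
  let ?N = "nbrs G h"
  have hN: "h \<notin> ?N" using nbrs_irrefl[OF simple] .
  have "card (verts G - insert h ?N) = 1"
    using h hN fin nbrs_subset by (simp add: card_Diff_subset)
  then obtain w where w: "verts G - insert h ?N = {w}" by (auto simp: card_1_singleton_iff)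
  have wh: "w \<noteq> h" "w \<notin> ?N" "w \<in> verts G" using w by auto
  have V: "verts G = insert h (insert w ?N)" using w h nbrs_subset[of h] by auto
  define M where "M = k - 11 / 2"
  define y where "y v = (if v = h then M else if v = w then 3 / 5
      else if v \<in> nbrs G w then 3 / 2 else 1)" for v
  have yN: "y u = 1 + (if u \<in> nbrs G w then 1 / 2 else 0)" if "u \<in> ?N" for u
    using that hN wh by (auto simp: y_def)
  have sumN: "sum y S = real (card S) + real (card (S \<inter> nbrs G w)) / 2" if "S \<subseteq> ?N" for S
  proof -
    have "finite S" using that fin finite_subset by blast
    have "sum y S = (\<Sum>u\<in>S. 1 + (if u \<in> nbrs G w then 1 / 2 else 0))"
      using that yN by (intro sum.cong) auto
    also have "\<dots> = real (card S) + real (card (S \<inter> nbrs G w)) / 2"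
      using \<open>finite S\<close> by (simp add: sum.distrib sum.If_cases Int_def)
    finally show ?thesis .
  qed
  have Nw: "card (?N \<inter> nbrs G w) \<le> 2" using common_nbrs[of h w] wh by simp
  have inner: "card (nbrs G u \<inter> ?N) \<le> 2" "card (nbrs G u \<inter> ?N \<inter> nbrs G w) \<le> 1"
    if u: "u \<in> ?N" for u
  proof -
    have uh: "u \<noteq> h" using u hN by blast
    then show "card (nbrs G u \<inter> ?N) \<le> 2" using common_nbrs by simp
    show "card (nbrs G u \<inter> ?N \<inter> nbrs G w) \<le> 1"
    proof (rule ccontr)
      assume "\<not> ?thesis"
      then have "2 \<le> card (nbrs G u \<inter> ?N \<inter> nbrs G w)" by simp
      then obtain T where "T \<subseteq> nbrs G u \<inter> ?N \<inter> nbrs G w" "card T = 2"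
        by (metis obtain_subset_with_card_n)
      then obtain a b where ab: "a \<noteq> b" "{a, b} \<subseteq> nbrs G u \<inter> ?N \<inter> nbrs G w"
        by (auto simp: card_2_iff)
      have "u \<noteq> w" using u wh by blast
      then have "card {h, w, u} = 3" using uh wh by simp
      moreover have "{h, w, u} \<subseteq> nbrs G a \<inter> nbrs G b"
        using ab nbrs_sym[OF simple] by simp
      then have "card {h, w, u} \<le> card (nbrs G a \<inter> nbrs G b)" using fin by (intro card_mono) auto
      ultimately show False using common_nbrs[OF ab(1)] by simp
    qed
  qed
  show ?thesis
  proof (rule q_index_le_weights[OF simple])
    show "verts G \<noteq> {}" using h by blast
    show "y v > 0" for v using k(1) by (simp add: y_def M_def)
    fix v assume "v \<in> verts G"
    then consider "v = h" | "v = w" | "v \<in> ?N" "v \<notin> nbrs G w" | "v \<in> ?N" "v \<in> nbrs G w"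
      using V by blast
    then show "laplace G y v \<le> k * y v"
    proof cases
      case 1
      have "sum y ?N \<le> real (deg h) + 1" using sumN[of ?N] Nw by simp
      moreover have "real (deg h) = real nverts - 2" using h(2) by linarith
      ultimately have "laplace G y h \<le> (real nverts - 2) * M + (real nverts - 1)"
        by (simp add: laplace_deg y_def)
      also have "\<dots> \<le> (real nverts - 2) * M + (k - real nverts + 2) * M"
        using k(2) by (simp add: M_def)
      also have "\<dots> = k * M" by (simp add: algebra_simps)
      finally show ?thesis using 1 by (simp add: y_def)
    next
      case 2
      have "w \<notin> nbrs G w" "h \<notin> nbrs G w"
        using nbrs_irrefl[OF simple] wh nbrs_sym[OF simple] by blast+
      then have sub: "nbrs G w \<subseteq> ?N" using V nbrs_subset[of w] by auto
      then have d: "deg w \<le> 2" using Nw by (simp add: Int_absorb1)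
      then have "laplace G y w \<le> 21 / 5"
        using sumN[OF sub] wh by (simp add: laplace_deg y_def)
      then show ?thesis using 2 k(1) wh by (simp add: y_def)
    next
      case 3
      have hv: "h \<in> nbrs G v" "w \<notin> nbrs G v" "v \<noteq> h" "v \<noteq> w"
        using 3 nbrs_sym[OF simple] hN wh by blast+
      then have "nbrs G v = insert h (nbrs G v \<inter> ?N)" using V nbrs_subset[of v] by blast
      moreover have "h \<notin> nbrs G v \<inter> ?N" using hN by blast
      ultimately have "deg v = Suc (card (nbrs G v \<inter> ?N))"
        "sum y (nbrs G v) = y h + sum y (nbrs G v \<inter> ?N)"
        using fin by (metis card_insert_disjoint finite_Int, metis sum.insert finite_Int)
      moreover have "sum y (nbrs G v \<inter> ?N) \<le> 5 / 2"
        using inner[OF 3(1)] by (subst sumN) auto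
      ultimately have "laplace G y v \<le> 3 + (M + 5 / 2)"
        using inner(1)[OF 3(1)] hv 3 by (simp add: laplace_deg y_def)
      then show ?thesis using 3 hv by (simp add: y_def M_def)
    next
      case 4
      have hv: "h \<in> nbrs G v" "w \<in> nbrs G v" "v \<noteq> h" "v \<noteq> w"
        using 4 nbrs_sym[OF simple] hN wh by blast+
      then have "nbrs G v = insert h (insert w (nbrs G v \<inter> ?N))" using V nbrs_subset[of v] by blast
      moreover have "h \<notin> insert w (nbrs G v \<inter> ?N)" "w \<notin> nbrs G v \<inter> ?N" using hN wh by blast+
      ultimately have deg: "deg v = Suc (Suc (card (nbrs G v \<inter> ?N)))"
        and sum: "sum y (nbrs G v) = y h + (y w + sum y (nbrs G v \<inter> ?N))"
        using fin by (metis card_insert_disjoint finite_Int finite_insert, metis sum.insert finite_Int finite_insert)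
      have y: "y h = M" "y w = 3 / 5" "y v = 3 / 2" using 4 hv wh by (auto simp: y_def)
      have "laplace G y v = real (Suc (Suc (card (nbrs G v \<inter> ?N)))) * (3 / 2) +
          (M + (3 / 5 + sum y (nbrs G v \<inter> ?N)))"
        by (simp only: laplace_deg deg sum y)
      moreover have "sum y (nbrs G v \<inter> ?N) \<le> 5 / 2"
        using inner[OF 4(1)] by (subst sumN) auto
      moreover have "real (Suc (Suc (card (nbrs G v \<inter> ?N)))) * (3 / 2) \<le> 4 * (3 / 2)"
        using inner(1)[OF 4(1)] by (intro mult_right_mono) auto
      ultimately have "laplace G y v \<le> 6 + (M + 3 / 5 + 5 / 2)" by linarith
      then show ?thesis unfolding y(3) using k(1) by (simp add: M_def)
    qed
  qed
qed

end

section \<open>The fan\<close>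

abbreviation (input) fan :: "nat \<Rightarrow> (unit + nat) graph" where
  "fan m \<equiv> K1 \<nabla> path_graph m"

lemma fan_verts: "verts (fan m) = insert (Inl ()) (Inr ` {..<m})"
  by (auto simp: graph_join_def K1_def path_graph_def)

lemma fan_edges:
  "edges (fan m) = (\<lambda>i. {Inl (), Inr i}) ` {..<m} \<union> (\<lambda>i. {Inr i, Inr (Suc i)}) ` {..<m - 1}"
proof -
  have "edges (path_graph m) = (\<lambda>i. {i, Suc i}) ` {..<m - 1}"
    by (auto simp: path_graph_def)
  then have "image Inr ` edges (path_graph m) = (\<lambda>i. {Inr i :: unit + nat, Inr (Suc i)}) ` {..<m - 1}"
    by (simp add: image_image)
  then show ?thesis by (auto simp: graph_join_def K1_def path_graph_def)
qed

lemma simple_graph_fan: "simple_graph (fan m)"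
  by (auto simp: simple_graph_def fan_verts fan_edges)

lemma fan_energy:
  "energy (fan m) y = (\<Sum>i<m. (y (Inl ()) + y (Inr i))\<^sup>2) + (\<Sum>i<m - 1. (y (Inr i) + y (Inr (Suc i)))\<^sup>2)"
proof -
  have "energy (fan m) y = (\<Sum>e\<in>(\<lambda>i. {Inl (), Inr i}) ` {..<m}. (sum y e)\<^sup>2) +
      (\<Sum>e\<in>(\<lambda>i. {Inr i, Inr (Suc i)}) ` {..<m - 1}. (sum y e)\<^sup>2)"
    unfolding energy_def fan_edges by (rule sum.union_disjoint) (auto simp: doubleton_eq_iff)
  also have "(\<Sum>e\<in>(\<lambda>i. {Inl (), Inr i}) ` {..<m}. (sum y e)\<^sup>2) = (\<Sum>i<m. (y (Inl ()) + y (Inr i))\<^sup>2)"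
    by (subst sum.reindex) (auto simp: inj_on_def doubleton_eq_iff)
  also have "(\<Sum>e\<in>(\<lambda>i. {Inr i, Inr (Suc i)}) ` {..<m - 1}. (sum y e)\<^sup>2) =
      (\<Sum>i<m - 1. (y (Inr i) + y (Inr (Suc i)))\<^sup>2)"
    by (subst sum.reindex) (auto simp: inj_on_def doubleton_eq_iff)
  finally show ?thesis .
qed

lemma fan_norm: "(\<Sum>v\<in>verts (fan m). (y v)\<^sup>2) = (y (Inl ()))\<^sup>2 + (\<Sum>i<m. (y (Inr i))\<^sup>2)"
  unfolding fan_verts by (subst sum.insert) (auto simp: sum.reindex)

lemma q_index_fan_greater:
  assumes "k * (a\<^sup>2 + (\<Sum>i<m. (z i)\<^sup>2)) < (\<Sum>i<m. (a + z i)\<^sup>2) + (\<Sum>i<m - 1. (z i + z (Suc i))\<^sup>2)"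
  shows "k < q_index (fan m)"
proof (rule q_index_greater[OF simple_graph_fan])
  show "verts (fan m) \<noteq> {}" by (simp add: fan_verts)
  show "k * (\<Sum>v\<in>verts (fan m). (case_sum (\<lambda>_. a) z v)\<^sup>2) < energy (fan m) (case_sum (\<lambda>_. a) z)"
    unfolding fan_energy fan_norm using assms by simp
qed

text \<open>The test function is 1 on the path.  Its value at the hub is the maximiser of the quadratic
  polynomial that arises, and the last hypothesis says that the maximum is positive.\<close>

lemma q_index_fan_greater_constant:
  assumes n: "n \<ge> 2" and s: "0 < s"
    and k: "k = real n - 1 + s"
    and less: "s * (k * (real n - 1) - 5 * real n + 9) < (real n - 1)\<^sup>2"
  shows "k < q_index (fan (n - 1))"
proof -
  let ?N = "real n - 1"
  define a where "a = ?N / s"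
  have a: "s * a = ?N" using s by (simp add: a_def)
  have "s * (a * ?N) = ?N\<^sup>2" using a by (metis mult.assoc power2_eq_square)
  then have "s * (k * ?N - 5 * real n + 9) < s * (a * ?N)" using less by (simp only:)
  then have "k * ?N - 5 * real n + 9 < a * ?N" by (simp only: mult_less_cancel_left_pos[OF s])
  moreover have "k * a\<^sup>2 = ?N * a\<^sup>2 + ?N * a"
  proof -
    have "k * a\<^sup>2 = ?N * a\<^sup>2 + (s * a) * a" unfolding k by (simp only: power2_eq_square algebra_simps)
    then show ?thesis unfolding a .
  qed
  ultimately have "k * (a\<^sup>2 + ?N) < ?N * (a + 1)\<^sup>2 + 4 * (real n - 2)"
    by (simp add: power2_eq_square algebra_simps)
  moreover have "real (n - 1) = ?N" "real (n - 1 - 1) = real n - 2" using n by auto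
  ultimately have "k * (a\<^sup>2 + (\<Sum>i<n - 1. 1\<^sup>2)) < (\<Sum>i<n - 1. (a + 1)\<^sup>2) + (\<Sum>i<n - 1 - 1. (1 + 1)\<^sup>2)"
    by (simp add: mult.commute)
  then show ?thesis by (rule q_index_fan_greater)
qed

lemma q_index_fan_large:
  assumes n: "n \<ge> 7"
  shows "real n + 8 / (2 * real n - 3) < q_index (fan (n - 1))"
proof (rule q_index_fan_greater_constant)
  \<comment> \<open>In terms of \<open>t\<close> and with denominators cleared, the condition reads \<open>24 t\<^sup>2 > 216 t + 128\<close>.\<close>
  define t where "t = 2 * real n - 3"
  have t: "t \<ge> 11" using n by (simp add: t_def)
  have nt: "real n = (t + 3) / 2" by (simp add: t_def)
  have "0 < t * (24 * t - 216) - 128"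
  proof -
    have "11 * 48 \<le> t * (24 * t - 216)" using t by (intro mult_mono) auto
    then show ?thesis by simp
  qed
  then have "(t + 8) * (t * (t - 3)\<^sup>2 + 16 * (t + 1)) < t\<^sup>2 * (t + 1)\<^sup>2"
    by (simp add: power2_eq_square algebra_simps)
  moreover have "4 * t\<^sup>2 * ((1 + 8 / t) * (((t + 3) / 2 + 8 / t) * ((t + 3) / 2 - 1) - 5 * ((t + 3) / 2) + 9))
      = (t + 8) * (t * (t - 3)\<^sup>2 + 16 * (t + 1))"
    using t by (simp add: field_simps power2_eq_square)
  moreover have "(t + 3) / 2 - 1 = (t + 1) / 2" by (simp add: field_simps)
  then have "4 * t\<^sup>2 * ((t + 3) / 2 - 1)\<^sup>2 = 4 * t\<^sup>2 * ((t + 1) / 2)\<^sup>2" by (simp only:)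
  then have "4 * t\<^sup>2 * ((t + 3) / 2 - 1)\<^sup>2 = t\<^sup>2 * (t + 1)\<^sup>2" unfolding power_divide by simp
  ultimately have "4 * t\<^sup>2 * ((1 + 8 / t) * (((t + 3) / 2 + 8 / t) * ((t + 3) / 2 - 1) - 5 * ((t + 3) / 2) + 9))
      < 4 * t\<^sup>2 * ((t + 3) / 2 - 1)\<^sup>2"
    by (simp only:)
  moreover have "0 < 4 * t\<^sup>2" using t by simp
  ultimately have "(1 + 8 / t) * (((t + 3) / 2 + 8 / t) * ((t + 3) / 2 - 1) - 5 * ((t + 3) / 2) + 9)
      < ((t + 3) / 2 - 1)\<^sup>2"
    by (simp only: mult_less_cancel_left_pos)
  then show "(1 + 8 / (2 * real n - 3)) * ((real n + 8 / (2 * real n - 3)) * (real n - 1) - 5 * real n + 9)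
      < (real n - 1)\<^sup>2"
    unfolding t_def[symmetric] unfolding nt .
  show "0 < 1 + 8 / (2 * real n - 3)" using t by (simp add: t_def add_pos_pos)
qed (use n in auto)

lemma q_index_fan_small:
  assumes "n \<in> {2, 3, 4}"
  shows "2 * real (n - 2) < q_index (fan (n - 1))"
  by (rule q_index_fan_greater[where a = 1 and z = "\<lambda>_. 1"]) (use assms in auto)

text \<open>Functions that are constant on the path only reach 6 here; lowering the values at its ends, where the
  degree is smaller, gives more.\<close>

lemma q_index_fan_five: "6 < q_index (fan 4)"
  by (rule q_index_fan_greater[where a = 20 and z = "\<lambda>i. if i = 0 \<or> i = 3 then 9 else 11"])
     (simp add: lessThan_nat_numeral lessThan_Suc)

lemma q_index_fan_six: "41 / 6 < q_index (fan 5)"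
  using q_index_fan_greater_constant[of 6 "11 / 6" "41 / 6"] by (simp add: power2_eq_square)

section \<open>Graphs with a vertex adjacent to all others\<close>

lemma fan_iso:
  assumes ps: "distinct ps" "h \<notin> set ps" and F: "verts F = insert h (set ps)"
    "edges F = (\<lambda>u. {h, u}) ` set ps \<union> path_edges ps"
  shows "fan (length ps) \<cong>\<^sub>g F"
proof -
  let ?H = "fan (length ps)" and ?g = "case_sum (\<lambda>_. h) ((!) ps)"
  have pe: "path_edges qs = (\<lambda>i. {qs ! i, qs ! Suc i}) ` {..<length qs - 1}" for qs :: "'a list"
  proof (induction qs rule: path_edges.induct)
    case (1 u v qs)
    have "{..<length (u # v # qs) - 1} = insert 0 (Suc ` {..<length (v # qs) - 1})"
      by (auto simp: lessThan_Suc_eq_insert_0)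
    then show ?case using 1 by (simp add: image_image)
  qed auto
  have set: "set ps = (!) ps ` {..<length ps}" by (auto simp: set_conv_nth)
  have inj: "inj_on ?g (verts ?H)"
    using ps by (auto simp: fan_verts inj_on_def nth_eq_iff_index_eq dest: nth_mem)
  have "?g ` verts ?H = verts F" unfolding fan_verts F(1) set by (auto simp: image_image)
  then have bij: "bij_betw ?g (verts ?H) (verts F)" using inj by (simp add: bij_betw_def)
  have E: "(`) ?g ` edges ?H = edges F"
    unfolding fan_edges F(2) set pe by (simp add: image_Un image_image)
  have "{u, v} \<in> edges ?H \<longleftrightarrow> {?g u, ?g v} \<in> edges F"
    if uv: "u \<in> verts ?H" "v \<in> verts ?H" for u v
  proof -
    have "inj_on ((`) ?g) (Pow (verts ?H))" by (rule inj_on_image_Pow[OF inj])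
    moreover have "{u, v} \<in> Pow (verts ?H)" using uv by simp
    moreover have "edges ?H \<subseteq> Pow (verts ?H)"
      using simple_graph_fan[of "length ps"] by (auto simp: simple_graph_def)
    ultimately have "?g ` {u, v} \<in> (`) ?g ` edges ?H \<longleftrightarrow> {u, v} \<in> edges ?H"
      by (rule inj_on_image_mem_iff)
    then show ?thesis unfolding E by simp
  qed
  then show ?thesis unfolding graph_iso_def using bij by blast
qed

context sparse_neighbourhoods
begin

text \<open>The list of neighbours of \<open>h\<close> spans a fan on the vertices of \<open>G\<close> that contains all edges of \<open>G\<close>.\<close>

lemma dominated_iso_or_less:
  assumes h: "h \<in> verts G" "Suc (deg h) = nverts"
  shows "G \<cong>\<^sub>g fan (nverts - 1) \<or> q_index G < q_index (fan (nverts - 1))"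
proof -
  obtain ps where ps: "distinct ps" "set ps = nbrs G h"
    and path: "\<And>e. e \<in> edges G \<Longrightarrow> e \<subseteq> nbrs G h \<Longrightarrow> e \<in> path_edges ps"
    using nbrs_path[of h] by (elim exE conjE) (rule that, auto)
  have hps: "h \<notin> set ps" using ps nbrs_irrefl[OF simple] by simp
  have len: "length ps = nverts - 1" using ps h distinct_card[of ps] by simp
  have V: "verts G = insert h (set ps)"
    using card_subset_eq[of "verts G" "insert h (set ps)"] fin h ps hps nbrs_subset[of h] by simp
  define F where "F = \<lparr>verts = verts G, edges = (\<lambda>u. {h, u}) ` set ps \<union> path_edges ps\<rparr>"
  have F: "verts F = verts G" "edges F = (\<lambda>u. {h, u}) ` set ps \<union> path_edges ps"
    by (simp_all add: F_def)
  have iso: "fan (nverts - 1) \<cong>\<^sub>g F"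
    using fan_iso[OF ps(1) hps, of F] F V len by simp
  have card: "card e = 2" if "distinct qs" "e \<in> path_edges qs" for e and qs :: "'a list"
    using that by (induction qs rule: path_edges.induct) auto
  have "e \<subseteq> verts F \<and> card e = 2" if "e \<in> edges F" for e
    using that hps card[OF ps(1)] path_edges_subset[of e ps] unfolding F V by (auto simp: card_insert_if)
  then have simpleF: "simple_graph F" using fin by (simp add: simple_graph_def F)
  have sub: "edges G \<subseteq> edges F"
  proof
    fix e assume e: "e \<in> edges G"
    obtain u v where uv: "u \<noteq> v" "e = {u, v}" "u \<in> verts G" "v \<in> verts G"
      by (rule edge_cases[OF simple e])
    consider "u = h" | "v = h" | "u \<in> set ps" "v \<in> set ps" using uv V by auto
    then show "e \<in> edges F"
    proof cases
      case 3
      then show ?thesis using path[OF e] uv ps F by simp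
    qed (use uv V F in \<open>auto simp: insert_commute\<close>)
  qed
  have q: "q_index (fan (nverts - 1)) = q_index F"
    by (rule q_index_iso[OF simple_graph_fan simpleF _ iso]) (simp add: fan_verts)
  show ?thesis
  proof (cases "edges G = edges F")
    case True
    then have "F \<cong>\<^sub>g G" unfolding graph_iso_def F(1) by (intro exI[of _ id]) auto
    moreover have "G = F" using True F(1) by simp
    ultimately show ?thesis using graph_iso_sym[OF iso] by simp
  next
    case False
    have "{h, u} \<in> edges G" if "u \<in> verts G" "u \<noteq> h" for u
      using that V ps nbrs_iff[OF simple] by auto
    then have "q_index G < q_index F"
      using False sub h by (intro q_index_strict_mono_dominated[OF simple simpleF F(1)]) auto
    then show ?thesis unfolding q by simp
  qed
qed

end

section \<open>Comparison with the fan\<close>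

context sparse_neighbourhoods
begin

lemma undominated_less:
  assumes n: "nverts \<ge> 2" and d: "\<And>v. v \<in> verts G \<Longrightarrow> deg v + 2 \<le> nverts"
  shows "q_index G < q_index (fan (nverts - 1))"
proof -
  have ne: "verts G \<noteq> {}" using n by auto
  consider "nverts \<in> {2, 3, 4}" | "nverts = 5" | "nverts = 6" | "nverts \<ge> 7" using n by force
  then show ?thesis
  proof cases
    case 1
    have "deg v \<le> nverts - 2" if "v \<in> verts G" for v using d[OF that] by linarith
    from q_index_le_max_degree[OF ne this] q_index_fan_small[OF 1] show ?thesis by linarith
  next
    case 2
    have "q_index G \<le> 6"
      by (rule q_index_le_degree_weights[OF ne, of 3]) (use d 2 in force)+
    then show ?thesis using q_index_fan_five 2 by simp
  next
    case 3
    have "q_index G \<le> 41 / 6" by (rule q_index_le_six) (use d 3 in force)+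
    then show ?thesis using q_index_fan_six 3 by simp
  next
    case 4
    let ?n = "real nverts"
    \<comment> \<open>The fan exceeds \<open>n\<close> by more than this \<open>e\<close>, which is simple but still large enough for \<open>n = 7\<close>, where
      the vertices of degree \<open>n - 2\<close> leave little room.\<close>
    define e where "e = 8 / (2 * ?n - 3)"
    have n7: "?n \<ge> 7" using 4 by simp
    have pos: "2 * ?n - 3 > 0" using n7 by simp
    have e: "e * (2 * ?n - 3) = 8"
      using nonzero_mult_div_cancel_right[of "2 * ?n - 3" 8] pos
      unfolding e_def times_divide_eq_left by linarith
    have "e > 0" unfolding e_def using pos by simp
    have fan: "?n + e < q_index (fan (nverts - 1))" unfolding e_def by (rule q_index_fan_large[OF 4])
    have "q_index G \<le> ?n + e"
    proof (cases "\<exists>h\<in>verts G. deg h + 2 = nverts")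
      case True
      then obtain h where h: "h \<in> verts G" "deg h + 2 = nverts" by blast
      show ?thesis
      proof (rule q_index_le_hub[OF h])
        show "36 / 5 \<le> ?n + e"
        proof (cases "nverts = 7")
          case True
          then show ?thesis by (simp add: e_def)
        next
          case False
          then have "?n \<ge> 8" using 4 by simp
          then show ?thesis using \<open>e > 0\<close> by linarith
        qed
        have "(?n + e - ?n + 2) * (?n + e - 11 / 2) = 2 * ?n - 11 + e * ?n - 7 / 2 * e + e\<^sup>2"
          by (simp add: power2_eq_square algebra_simps)
        also have "\<dots> = 2 * ?n - 7 - 2 * e + e\<^sup>2" using e by (simp add: algebra_simps)
        also have "\<dots> \<ge> 2 * ?n - 8"
          using zero_le_power2[of "e - 1"] by (simp add: power2_eq_square algebra_simps)
        finally have "2 * ?n - 8 \<le> (?n + e - ?n + 2) * (?n + e - 11 / 2)" .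
        then show "?n - 1 \<le> (?n + e - ?n + 2) * (?n + e - 11 / 2)" using n7 by linarith
      qed
    next
      case False
      \<comment> \<open>This is \<open>m + 1 + (2n - 4) / m\<close> for \<open>m = n - 3\<close>.\<close>
      define k where "k = ?n + 2 / (?n - 3)"
      have "q_index G \<le> k"
      proof (rule q_index_le_degree_weights[OF ne, of "nverts - 3"])
        show "deg v \<le> nverts - 3" if "v \<in> verts G" for v
          using d[OF that] False that by force
        have m: "real (nverts - 3) = ?n - 3" using 4 by simp
        have "2 / (?n - 3) * (?n - 3) = 2"
          using nonzero_mult_div_cancel_right[of "?n - 3" 2] n7 unfolding times_divide_eq_left by linarith
        then show "k * real (nverts - 3) = real (nverts - 3) * (real (nverts - 3) + 1) + 2 * ?n - 4"
          unfolding m k_def by (simp add: algebra_simps)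
        have "?n < k" using n7 by (simp add: k_def)
        then show "?n + 6 \<le> 2 * k" using n7 by linarith
      qed (use 4 in auto)
      also have "2 / (?n - 3) \<le> e" using n7 by (simp add: e_def field_simps)
      then have "k \<le> ?n + e" by (simp add: k_def)
      finally show ?thesis .
    qed
    then show ?thesis using fan by linarith
  qed
qed

end

theorem theorem3p5:
  fixes G :: "'a graph" and n :: nat
  assumes "simple_graph G" and "card (verts G) = n" and "n \<ge> 1"
    and "outerplanar G"
  defines "H \<equiv> K1 \<nabla> path_graph (n - 1)"
  shows "q_index G \<le> q_index H \<and> (q_index G = q_index H \<longleftrightarrow> G \<cong>\<^sub>g H)"
proof -
  interpret sparse_neighbourhoods G
    by (rule outerplanar_sparse_neighbourhoods[OF assms(1,4)])
  have ne: "verts G \<noteq> {}" using assms(2,3) by auto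
  have eq: "q_index G = q_index H" if "G \<cong>\<^sub>g H"
    unfolding H_def by (rule q_index_iso[OF simple simple_graph_fan ne]) (use that in \<open>simp only: H_def\<close>)
  have "G \<cong>\<^sub>g H \<or> q_index G < q_index H"
  proof (cases "\<exists>h\<in>verts G. Suc (deg h) = n")
    case True
    then obtain h where "h \<in> verts G" "Suc (deg h) = nverts" using assms(2) by auto
    then show ?thesis using dominated_iso_or_less[of h] assms(2) by (simp only: H_def)
  next
    case False
    have d: "deg v + 2 \<le> n" if "v \<in> verts G" for v
      using deg_less_order[OF that] False that assms(2) by force
    moreover have "n \<ge> 2" using ne d by force
    ultimately show ?thesis using undominated_less assms(2) unfolding H_def by simp
  qed
  then show ?thesis using eq by auto
qed

end
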